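(* Let $K$ be an infinite field. If $G\subset G'$ are graphs on $n$ vertices (that is, $G$ and $G'$ both have vertex set $[n]$ and every edge of $G$ is an edge of $G'$), then $$\ell(J_G)\le \ell(J_{G'}).$$
   Context: All graphs are finite and simple; a graph on $n$ vertices has vertex set $V=[n]=\{1,\ldots,n\}$ and edge set $E$. The binomial edge ideal of $G=(V,E)$ is $J_G=(x_iy_j-x_jy_i \mid \{i,j\}\in E)\subset S=K[x_1,\ldots,x_n,y_1,\ldots,y_n]$. For a homogeneous ideal $I$ in a polynomial ring $A$ over $K$ with homogeneous maximal ideal $\mathfrak m$ (generated by all the variables of $A$), the Rees algebra is $A[It]=\bigoplus_{k\ge 0} I^k t^k$, the special fiber ring is $F(I)=A[It]/\mathfrak m A[It]$, and the analytic spread is $\ell(I)=\dim F(I)$ (Krull dimension). *)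

theory Defs
  imports
    "HOL-Algebra.Ideal_Product"
    "HOL-Algebra.QuotRing"
    "HOL-Algebra.UnivPoly"
    "HOL-Library.Poly_Mapping"
    "HOL-Library.Extended_Real"
begin

section \<open>Krull dimension and analytic spread\<close>

text \<open>
  The supremum is taken in the extended reals, so a ring without prime ideals, that is the zero
  ring, has dimension minus infinity.
\<close>
definition krull_dim :: "('a, 'm) ring_scheme \<Rightarrow> ereal" where
  "krull_dim R = Sup {ereal (real d) | d.
     \<exists>P :: nat \<Rightarrow> 'a set. (\<forall>i\<le>d. primeideal (P i) R) \<and> (\<forall>i<d. P i \<subset> P (Suc i))}"

text \<open>
  The Rees algebra as the subring of the univariate polynomial ring over \<open>A\<close> (with variable \<open>t\<close>)
  of those polynomials whose coefficient of \<open>t^k\<close> lies in \<open>I^k\<close>. In the monoid \<open>ideals_set A\<close>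
  multiplication is the product of ideals and the unit is the unit ideal, so \<open>I^0 = A\<close>.
\<close>
definition rees_algebra :: "('a, 'm) ring_scheme \<Rightarrow> 'a set \<Rightarrow> ('a, nat \<Rightarrow> 'a) up_ring" where
  "rees_algebra A I = UP A \<lparr>carrier :=
     {f \<in> carrier (UP A). \<forall>k. up_ring.coeff (UP A) f k \<in> I [^]\<^bsub>ideals_set A\<^esub> (k :: nat)}\<rparr>"

definition special_fiber :: "('a, 'm) ring_scheme \<Rightarrow> 'a set \<Rightarrow> 'a set \<Rightarrow> (nat \<Rightarrow> 'a) set ring" where
  "special_fiber A \<mm> I = rees_algebra A I Quot
     (genideal (rees_algebra A I) ((\<lambda>a. up_ring.monom (UP A) a 0) ` \<mm>))"

definition analytic_spread :: "('a, 'm) ring_scheme \<Rightarrow> 'a set \<Rightarrow> 'a set \<Rightarrow> ereal" where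
  "analytic_spread A \<mm> I = krull_dim (special_fiber A \<mm> I)"

section \<open>Polynomial rings\<close>

text \<open>
  A monomial is a finitely supported exponent function, a polynomial a finitely supported
  coefficient function on monomials; multiplication on this type is convolution.
\<close>
type_synonym ('v, 'k) mpoly = "('v \<Rightarrow>\<^sub>0 nat) \<Rightarrow>\<^sub>0 'k"

definition mvar :: "'v \<Rightarrow> ('v, 'k::field) mpoly" where
  "mvar v = Poly_Mapping.single (Poly_Mapping.single v 1) 1"

definition mpoly_ring :: "'v set \<Rightarrow> ('v, 'k::field) mpoly ring" where
  "mpoly_ring V = \<lparr>carrier = {p. \<forall>m\<in>Poly_Mapping.keys p. Poly_Mapping.keys m \<subseteq> V},
     mult = (*), one = 1, zero = 0, add = (+)\<rparr>"

definition irrelevant_ideal :: "'v set \<Rightarrow> ('v, 'k::field) mpoly set" where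
  "irrelevant_ideal V = genideal (mpoly_ring V) (mvar ` V)"

section \<open>Binomial edge ideals\<close>

definition simple_graph :: "nat \<Rightarrow> nat set set \<Rightarrow> bool" where
  "simple_graph n E \<longleftrightarrow> (\<forall>e\<in>E. e \<subseteq> {1..n} \<and> card e = 2)"

text \<open>
  The variable \<open>x_i\<close> is indexed by \<open>(False, i)\<close> and \<open>y_i\<close> by \<open>(True, i)\<close>.
\<close>
type_synonym xy = "bool \<times> nat"

definition xvar :: "nat \<Rightarrow> (xy, 'k::field) mpoly" where
  "xvar i = mvar (False, i)"

definition yvar :: "nat \<Rightarrow> (xy, 'k::field) mpoly" where
  "yvar i = mvar (True, i)"

definition xy_vars :: "nat \<Rightarrow> xy set" where
  "xy_vars n = UNIV \<times> {1..n}"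

text \<open>
  Each edge contributes its generator with both signs, according to the two orders of its
  endpoints.
\<close>
definition binomial_edge_ideal :: "nat \<Rightarrow> nat set set \<Rightarrow> (xy, 'k::field) mpoly set" where
  "binomial_edge_ideal n E = genideal (mpoly_ring (xy_vars n))
     {xvar i * yvar j - xvar j * yvar i | i j. {i, j} \<in> E}"

end

theory Submission
  imports Defs "HOL-Algebra.Subrings" "HOL-Computational_Algebra.Polynomial" "HOL-Library.Product_Lexorder"
begin

text \<open>
  The binomial edge ideal \<open>J\<close> of a graph is generated by quadrics \<open>f_e\<close>, one for each edge \<open>e\<close> up to sign.
  For an ideal generated by forms of a single degree the special fiber ring is the algebra \<open>K[f_e]\<close> that
  they generate inside the polynomial ring (\<open>analytic_spread_eq\<close>). A larger graph therefore has the
  larger special fiber ring, as subalgebras of one domain, and the theorem is an instance of the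
  monotonicity of Krull dimension for finitely generated algebras inside a domain
  (\<open>krull_dim_mono\<close>).

  Krull dimension is compared through algebraically independent elements. A chain of \<open>d + 1\<close> primes in
  the smaller algebra gives \<open>d\<close> independent elements, chosen one from each step of the chain
  (\<open>alg_indep_from_prime_chain\<close>). Conversely, let \<open>B\<close> be a finitely generated domain containing
  independent \<open>z_1, ..., z_d\<close>, and let \<open>A = K[z_1, ..., z_d]\<close>. By generic freeness there is a nonzero \<open>c\<close> in
  \<open>A\<close> such that every ideal of \<open>A[1/c]\<close> is contracted from \<open>B[1/c]\<close> (\<open>generic_freeness\<close>). Since \<open>K\<close> is
  infinite, \<open>c\<close> is nonzero at some point \<open>(l_1, ..., l_d)\<close> of \<open>K^d\<close>. The elements \<open>w_i = z_i - l_i\<close> form a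
  regular sequence in the polynomial ring \<open>A\<close> with \<open>c\<close> invertible modulo it, so they satisfy no
  collapsing identity

    \<open>w_1^m_1 (w_2^m_2 ( ... w_d^m_d (1 + a_d w_d) ... + a_2 w_2) + a_1 w_1) = 0\<close>

  over \<open>A[1/c]\<close>, and by contraction none over \<open>B\<close>. The absence of collapse yields a chain of primes
  of length \<open>d\<close> by prime avoidance (\<open>prime_chain_from_boundary\<close>), one strict inclusion for each \<open>w_i\<close>.
\<close>

section \<open>Subrings, ideals and primes of an ambient ring\<close>

text \<open>
  The algebras whose dimensions are compared are subrings of one polynomial ring, so rings are treated
  as subsets of a type; this makes inclusions between rings literal and lets the arithmetic of the type class apply.
\<close>

definition is_subring :: "'a::comm_ring_1 set \<Rightarrow> bool" where
  "is_subring A \<longleftrightarrow> 0 \<in> A \<and> 1 \<in> A \<and> (\<forall>a\<in>A. - a \<in> A)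
     \<and> (\<forall>a\<in>A. \<forall>b\<in>A. a + b \<in> A) \<and> (\<forall>a\<in>A. \<forall>b\<in>A. a * b \<in> A)"

definition is_ideal :: "'a::comm_ring_1 set \<Rightarrow> 'a set \<Rightarrow> bool" where
  "is_ideal I A \<longleftrightarrow> I \<subseteq> A \<and> 0 \<in> I \<and> (\<forall>a\<in>I. \<forall>b\<in>I. a + b \<in> I)
     \<and> (\<forall>a\<in>A. \<forall>b\<in>I. a * b \<in> I)"

definition is_prime :: "'a::comm_ring_1 set \<Rightarrow> 'a set \<Rightarrow> bool" where
  "is_prime P A \<longleftrightarrow> is_ideal P A \<and> 1 \<notin> P \<and> (\<forall>a\<in>A. \<forall>b\<in>A. a * b \<in> P \<longrightarrow> a \<in> P \<or> b \<in> P)"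

definition is_subfield :: "'a::comm_ring_1 set \<Rightarrow> bool" where
  "is_subfield K \<longleftrightarrow> is_subring K \<and> (\<forall>a\<in>K. a \<noteq> 0 \<longrightarrow> (\<exists>b\<in>K. a * b = 1))"

lemma is_subringD:
  assumes "is_subring A"
  shows "0 \<in> A" "1 \<in> A" "a \<in> A \<Longrightarrow> - a \<in> A" "a \<in> A \<Longrightarrow> b \<in> A \<Longrightarrow> a + b \<in> A"
    "a \<in> A \<Longrightarrow> b \<in> A \<Longrightarrow> a * b \<in> A" "a \<in> A \<Longrightarrow> b \<in> A \<Longrightarrow> a - b \<in> A" "a \<in> A \<Longrightarrow> a ^ k \<in> A"
proof -
  show *: "0 \<in> A" "1 \<in> A" "a \<in> A \<Longrightarrow> - a \<in> A" "a \<in> A \<Longrightarrow> b \<in> A \<Longrightarrow> a + b \<in> A"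
    "a \<in> A \<Longrightarrow> b \<in> A \<Longrightarrow> a * b \<in> A" for a b
    using assms by (auto simp: is_subring_def)
  show "a \<in> A \<Longrightarrow> b \<in> A \<Longrightarrow> a - b \<in> A"
    using *(4)[of a "- b"] *(3)[of b] by simp
  show "a \<in> A \<Longrightarrow> a ^ k \<in> A"
    by (induction k) (auto simp: *)
qed

lemma is_idealD:
  assumes "is_ideal I A"
  shows "I \<subseteq> A" "0 \<in> I" "a \<in> I \<Longrightarrow> b \<in> I \<Longrightarrow> a + b \<in> I" "a \<in> A \<Longrightarrow> b \<in> I \<Longrightarrow> a * b \<in> I"
    "a \<in> A \<Longrightarrow> b \<in> I \<Longrightarrow> b * a \<in> I"
  using assms by (auto simp: is_ideal_def mult.commute)

lemma is_ideal_diff: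
  assumes "is_subring A" "is_ideal I A" "a \<in> I" "b \<in> I"
  shows "a - b \<in> I"
proof -
  have "- 1 * b \<in> I"
    using assms by (intro is_idealD(4)[OF assms(2)] is_subringD(3)) (auto intro: is_subringD)
  from is_idealD(3)[OF assms(2,3) this] show ?thesis
    by simp
qed

lemma is_ideal_self: "is_subring A \<Longrightarrow> is_ideal A A"
  by (auto simp: is_ideal_def is_subring_def)

lemma is_ideal_sum:
  assumes "is_ideal I A" "\<And>i. i \<in> S \<Longrightarrow> f i \<in> I"
  shows "sum f S \<in> I"
  using assms by (induction S rule: infinite_finite_induct) (auto simp: is_ideal_def)

section \<open>Adjoining elements\<close>

definition polys_over :: "'a::zero set \<Rightarrow> 'a poly set" where
  "polys_over A = {p. \<forall>i. poly.coeff p i \<in> A}"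

lemma polys_over_coeff: "p \<in> polys_over A \<Longrightarrow> poly.coeff p i \<in> A"
  by (simp add: polys_over_def)

lemma polys_over_mono: "A \<subseteq> B \<Longrightarrow> polys_over A \<subseteq> polys_over B"
  by (auto simp: polys_over_def)

lemma polys_over_pCons: "0 \<in> A \<Longrightarrow> pCons a p \<in> polys_over A \<longleftrightarrow> a \<in> A \<and> p \<in> polys_over A"
  unfolding polys_over_def
  by (auto simp: coeff_pCons split: nat.splits)

lemma polys_over_induct [consumes 2, case_names zero pCons]:
  assumes "p \<in> polys_over A" "0 \<in> A" "Q 0"
    and "\<And>a p. a \<in> A \<Longrightarrow> p \<in> polys_over A \<Longrightarrow> Q p \<Longrightarrow> Q (pCons a p)"
  shows "Q p"
  using assms(1)
  by (induction p) (use assms in \<open>auto simp: polys_over_pCons\<close>)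

lemma polys_over_ideal:
  assumes "is_subring A" "is_ideal I A"
  shows "0 \<in> polys_over I" "p \<in> polys_over I \<Longrightarrow> q \<in> polys_over I \<Longrightarrow> p + q \<in> polys_over I"
    "p \<in> polys_over I \<Longrightarrow> q \<in> polys_over I \<Longrightarrow> p - q \<in> polys_over I"
    "p \<in> polys_over A \<Longrightarrow> q \<in> polys_over I \<Longrightarrow> p * q \<in> polys_over I"
    "a \<in> A \<Longrightarrow> q \<in> polys_over I \<Longrightarrow> smult a q \<in> polys_over I"
    "a \<in> I \<Longrightarrow> Polynomial.monom a k \<in> polys_over I"
    "a \<in> I \<Longrightarrow> [:a:] \<in> polys_over I"
  using assms is_idealD[OF assms(2)] is_ideal_diff[OF assms]
  by (auto simp: polys_over_def coeff_mult coeff_pCons intro!: is_ideal_sum[OF assms(2)] split: nat.splits)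

lemmas polys_over_subring = polys_over_ideal[OF _ is_ideal_self]

text \<open>
  For a subring \<open>A\<close> this is \<open>A[xs]\<close>. The recursion makes sense for any set of coefficients: applied to an
  ideal \<open>I\<close> of \<open>A\<close> it yields the extended ideal \<open>I A[xs]\<close>, and it is used in both ways.
\<close>

fun adjoin :: "'a::comm_ring_1 set \<Rightarrow> 'a list \<Rightarrow> 'a set" where
  "adjoin A [] = A"
| "adjoin A (x # xs) = {poly p x | p. p \<in> polys_over (adjoin A xs)}"

lemma adjoin_base: "0 \<in> A \<Longrightarrow> A \<subseteq> adjoin A xs"
proof (induction xs)
  case (Cons x xs)
  have "a \<in> adjoin A (x # xs)" if "a \<in> A" for a
    using Cons that by (auto intro!: exI[of _ "[:a:]"] simp: polys_over_def coeff_pCons split: nat.splits)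
  then show ?case by blast
qed auto

lemma is_ideal_adjoin_step:
  assumes A: "is_subring A" and I: "is_ideal I A"
  shows "is_ideal {poly p x | p. p \<in> polys_over I} {poly p x | p. p \<in> polys_over A}"
  unfolding is_ideal_def
proof (intro conjI ballI)
  show "{poly p x | p. p \<in> polys_over I} \<subseteq> {poly p x | p. p \<in> polys_over A}"
    using polys_over_mono[OF is_idealD(1)[OF I]] by blast
  show "0 \<in> {poly p x | p. p \<in> polys_over I}"
    using polys_over_ideal(1)[OF assms] by force
next
  fix a b assume "a \<in> {poly p x | p. p \<in> polys_over I}" "b \<in> {poly p x | p. p \<in> polys_over I}"
  then show "a + b \<in> {poly p x | p. p \<in> polys_over I}"
    using polys_over_ideal(2)[OF assms] by (fastforce simp flip: poly_add)
next
  fix a b assume "a \<in> {poly p x | p. p \<in> polys_over A}" "b \<in> {poly p x | p. p \<in> polys_over I}"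
  then show "a * b \<in> {poly p x | p. p \<in> polys_over I}"
    using polys_over_ideal(4)[OF assms] by (fastforce simp flip: poly_mult)
qed

lemma is_subring_adjoin_step:
  assumes A: "is_subring A"
  shows "is_subring {poly p x | p. p \<in> polys_over A}"
proof -
  note I = is_ideal_adjoin_step[OF A is_ideal_self[OF A], of x]
  have "1 \<in> {poly p x | p. p \<in> polys_over A}"
    using polys_over_subring(7)[OF A A is_subringD(2)[OF A]] by force
  moreover have "- a \<in> {poly p x | p. p \<in> polys_over A}" if a: "a \<in> {poly p x | p. p \<in> polys_over A}" for a
  proof -
    obtain p where "p \<in> polys_over A" "a = poly p x" using a by blast
    moreover have "- p \<in> polys_over A"
      using polys_over_subring(3)[OF A A polys_over_subring(1)[OF A A] \<open>p \<in> _\<close>] by simp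
    ultimately show ?thesis by force
  qed
  ultimately show ?thesis
    using I unfolding is_subring_def is_ideal_def by blast
qed

lemma is_subring_adjoin: "is_subring A \<Longrightarrow> is_subring (adjoin A xs)"
  by (induction xs) (use is_subring_adjoin_step in auto)

lemma is_ideal_adjoin: "is_subring A \<Longrightarrow> is_ideal I A \<Longrightarrow> is_ideal (adjoin I xs) (adjoin A xs)"
proof (induction xs)
  case (Cons x xs)
  then show ?case
    using is_ideal_adjoin_step[OF is_subring_adjoin[OF Cons.prems(1)] Cons.IH] by auto
qed auto

lemma adjoin_elements:
  assumes "is_subring A"
  shows "set xs \<subseteq> adjoin A xs"
proof (induction xs)
  case (Cons x xs)
  let ?B = "adjoin A xs"
  have B: "is_subring ?B" by (rule is_subring_adjoin[OF assms])
  have "x \<in> adjoin A (x # xs)"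
    using is_subringD(1,2)[OF B] 
    by (auto intro!: exI[of _ "[:0,1:]"] simp: polys_over_pCons polys_over_subring[OF B B])
  moreover have "?B \<subseteq> adjoin A (x # xs)"
    using adjoin_base[of ?B "[x]"] is_subringD(1)[OF B] by simp
  ultimately show ?case using Cons by auto
qed auto

lemma adjoin_least:
  assumes B: "is_subring B" and "0 \<in> A" "A \<subseteq> B" "set xs \<subseteq> B"
  shows "adjoin A xs \<subseteq> B"
  using assms(4)
proof (induction xs)
  case (Cons x xs)
  have "poly p x \<in> B" if "p \<in> polys_over (adjoin A xs)" for p
  proof -
    have "p \<in> polys_over B" using that Cons polys_over_mono[of "adjoin A xs" B] by auto
    then show ?thesis
      using is_subringD(1)[OF B]
      by (induction p rule: polys_over_induct) (use Cons.prems B is_subringD[OF B] in auto)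
  qed
  then show ?case by auto
qed (use assms in auto)

text \<open>
  With \<open>t\<close> in \<open>A\<close>, this compares extended ideals: if \<open>t I\<close> lies in \<open>I'\<close>, then \<open>t (I A[xs])\<close> lies in \<open>I' A[xs]\<close>.
\<close>

lemma adjoin_scale:
  assumes "\<And>y. y \<in> I \<Longrightarrow> t * y \<in> I'" "y \<in> adjoin I xs"
  shows "t * y \<in> adjoin I' xs"
  using assms(2)
proof (induction xs arbitrary: y)
  case (Cons x xs)
  then obtain p where p: "p \<in> polys_over (adjoin I xs)" "y = poly p x" by auto
  then have "smult t p \<in> polys_over (adjoin I' xs)"
    using Cons.IH by (auto simp: polys_over_def)
  then show ?case using p(2) by (force simp flip: poly_smult)
qed (use assms in auto)

lemma adjoin_absorb:
  assumes K: "is_subring K" and zs: "set zs \<subseteq> adjoin K xs"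
  shows "adjoin (adjoin K zs) xs = adjoin K xs"
proof
  note R = is_subring_adjoin[OF K]
  show "adjoin (adjoin K zs) xs \<subseteq> adjoin K xs"
    using adjoin_least[OF R is_subringD(1)[OF R]] adjoin_least[OF R is_subringD(1)[OF K] _ zs]
      adjoin_base[OF is_subringD(1)[OF K]] adjoin_elements[OF K] by blast
  show "adjoin K xs \<subseteq> adjoin (adjoin K zs) xs"
    using adjoin_least[OF is_subring_adjoin[OF R] is_subringD(1)[OF K]] adjoin_elements[OF R]
      adjoin_base[OF is_subringD(1)[OF K]] adjoin_base[OF is_subringD(1)[OF R]]
    by (meson subset_trans)
qed

section \<open>Generic freeness\<close>

text \<open>
  Over a ring that is not a field one divides after multiplying by a power of the leading
  coefficient. Dividing does not leave the ideal \<open>I\<close> that contains the coefficients of the dividend,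
  which is what makes the division usable for comparing \<open>I\<close> with its extension.
\<close>

lemma pseudo_division:
  fixes f :: "'a::idom poly"
  assumes A: "is_subring A" and I: "is_ideal I A" and f: "f \<in> polys_over A" and u: "u \<in> polys_over I"
  obtains j q r where "q \<in> polys_over I" "r \<in> polys_over I" "smult (lead_coeff f ^ j) u = q * f + r"
    "\<And>i. i \<ge> Polynomial.degree f \<Longrightarrow> poly.coeff r i = 0"
proof -
  let ?N = "Polynomial.degree f" and ?l = "lead_coeff f"
  have l: "?l \<in> A" using f by (rule polys_over_coeff)
  note P = polys_over_ideal[OF A I]
  have "\<exists>j q r. q \<in> polys_over I \<and> r \<in> polys_over I \<and> smult (?l ^ j) u = q * f + r \<and>
    (\<forall>i\<ge>?N. poly.coeff r i = 0)" if "\<forall>i\<ge>n. poly.coeff u i = 0" for n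
    using u that
  proof (induction n arbitrary: u)
    case 0
    then show ?case using P(1) by (intro exI[of _ 0] exI[of _ u]) (auto simp: poly_eq_iff)
  next
    case (Suc n)
    show ?case
    proof (cases "Suc n \<le> ?N")
      case True
      then show ?thesis
        using P(1) Suc.prems by (intro exI[of _ 0] exI[of _ u]) auto
    next
      case False
      let ?t = "Polynomial.monom (poly.coeff u n) (n - ?N)"
      let ?u = "smult ?l u - ?t * f"
      have t: "?t \<in> polys_over I" using Suc.prems by (intro P(6) polys_over_coeff)
      have u': "?u \<in> polys_over I"
        using P(3)[OF P(5)[OF l Suc.prems(1)] P(4)[OF f t]] by (simp add: mult.commute)
      have "poly.coeff ?u i = 0" if "i \<ge> n" for i
      proof (cases "i = n")
        case True
        then show ?thesis using False by (simp add: coeff_monom_mult)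
      next
        case neq: False
        then have "poly.coeff f (i - (n - ?N)) = 0"
          using that False by (intro coeff_eq_0) auto
        then show ?thesis using Suc.prems that neq by (simp add: coeff_monom_mult)
      qed
      then obtain j q r where *: "q \<in> polys_over I" "r \<in> polys_over I"
        "smult (?l ^ j) ?u = q * f + r" "\<forall>i\<ge>?N. poly.coeff r i = 0"
        using Suc.IH[OF u'] by blast
      have "smult (?l ^ Suc j) u = smult (?l ^ j) ?u + smult (?l ^ j) ?t * f"
        by (simp add: smult_diff_right mult.commute)
      also have "\<dots> = (q + smult (?l ^ j) ?t) * f + r"
        by (subst *(3)) (simp add: algebra_simps)
      finally show ?thesis
        using * P(2)[OF *(1) P(5)[OF is_subringD(7)[OF A l] t]] by blast
    qed
  qed
  from this[of "Suc (Polynomial.degree u)"] show ?thesis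
    using that coeff_eq_0 by (metis Suc_le_lessD)
qed

text \<open>
  After inverting one nonzero \<open>c\<close>, an ideal of \<open>A\<close> is contracted from its extension to \<open>A[x]\<close>, even if \<open>d\<close>
  is inverted in \<open>A[x]\<close>. If \<open>x\<close> is transcendental, \<open>A[x]\<close> is a polynomial ring and the leading
  coefficient of \<open>d\<close> will do. If \<open>x\<close> is algebraic, let \<open>f\<close> be an annihilating polynomial of minimal degree
  \<open>N\<close> and \<open>l\<close> its leading coefficient: over \<open>A[1/l]\<close> the ring \<open>A[x]\<close> becomes free on \<open>1, x, ..., x^(N-1)\<close>,
  so that an element of \<open>A\<close> in the extended ideal is its own constant coordinate and lies in \<open>I\<close>.
  In this case \<open>d\<close> is algebraic too and divides a nonzero element \<open>e\<close> of \<open>A\<close>; inverting \<open>e\<close> inverts \<open>d\<close>.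
\<close>

lemma generic_freeness_step:
  fixes A :: "'a::idom set"
  assumes A: "is_subring A" and d: "d \<in> {poly p x | p. p \<in> polys_over A}" "d \<noteq> 0"
  shows "\<exists>c\<in>A. c \<noteq> 0 \<and> (\<forall>I. is_ideal I A \<longrightarrow> (\<forall>a\<in>A. \<forall>k u. u \<in> polys_over I \<longrightarrow>
    d ^ k * a = poly u x \<longrightarrow> (\<exists>m. c ^ m * a \<in> I)))"
proof (cases "\<exists>f\<in>polys_over A. f \<noteq> 0 \<and> poly f x = 0")
  case False
  obtain p where p: "p \<in> polys_over A" "d = poly p x" using d by auto
  have "p \<noteq> 0" using d p by auto
  show ?thesis
  proof (intro bexI[of _ "lead_coeff p"] conjI allI impI ballI)
    fix I a k u
    assume I: "is_ideal I A" and a: "a \<in> A" and u: "u \<in> polys_over I" and eq: "d ^ k * a = poly u x"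
    have pk: "p ^ k \<in> polys_over A"
      by (induction k) (auto intro: polys_over_subring[OF A A] p(1) is_subringD(2)[OF A] simp: one_pCons)
    have "smult a (p ^ k) - u \<in> polys_over A"
      using polys_over_mono[OF is_idealD(1)[OF I]] u
      by (intro polys_over_subring[OF A A] pk a) auto
    moreover have "poly (smult a (p ^ k) - u) x = 0"
      using eq p by (simp add: mult.commute)
    ultimately have "smult a (p ^ k) = u"
      using False by (metis eq_iff_diff_eq_0)
    then have "lead_coeff p ^ k * a = poly.coeff u (Polynomial.degree (p ^ k))"
      by (auto simp: lead_coeff_power mult.commute)
    then show "\<exists>m. lead_coeff p ^ m * a \<in> I"
      using polys_over_coeff[OF u] by metis
  qed (use p \<open>p \<noteq> 0\<close> polys_over_coeff in auto)
next
  case True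
  define D where "D = {poly p x | p. p \<in> polys_over A}"
  have D: "is_subring D" unfolding D_def by (rule is_subring_adjoin_step[OF A])
  have polyD: "poly q x \<in> D" if "q \<in> polys_over A" for q using that by (auto simp: D_def)
  obtain f where f: "f \<in> polys_over A" "f \<noteq> 0" "poly f x = 0"
    and fmin: "\<And>g. g \<in> polys_over A \<Longrightarrow> g \<noteq> 0 \<Longrightarrow> poly g x = 0 \<Longrightarrow> Polynomial.degree f \<le> Polynomial.degree g"
    using ex_has_least_nat[of "\<lambda>f. f \<in> polys_over A \<and> f \<noteq> 0 \<and> poly f x = 0" _ Polynomial.degree] True
    by blast
  let ?l = "lead_coeff f"
  have l: "?l \<in> A" "?l \<noteq> 0" using f polys_over_coeff by auto
  \<comment> \<open>Minimality of \<open>f\<close>: no relation of smaller degree holds, so the powers of \<open>x\<close> below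
    \<open>degree f\<close> are linearly independent over \<open>A\<close>.\<close>
  have small: "g = 0" if "g \<in> polys_over A" "poly g x = 0" "\<And>i. i \<ge> Polynomial.degree f \<Longrightarrow> poly.coeff g i = 0" for g
  proof (rule ccontr)
    assume "g \<noteq> 0"
    then have "Polynomial.degree f \<le> Polynomial.degree g" using fmin that by blast
    then have "lead_coeff g = 0" using that(3) by simp
    then show False using \<open>g \<noteq> 0\<close> by simp
  qed
  obtain p where p: "p \<in> polys_over A" "d = poly p x" using d by auto
  \<comment> \<open>A nonzero polynomial \<open>h\<close> of least degree with \<open>h(x)\<close> in \<open>d A[x]\<close> is constant, because such polynomials
    are closed under division with remainder: \<open>h\<close> divides \<open>f\<close> up to a constant, which by minimality of \<open>f\<close>
    leaves a constant \<open>h\<close> or \<open>h(x) = 0\<close>, and the latter fails because reducing \<open>p\<close> modulo \<open>f\<close> gives a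
    smaller degree. The value of \<open>h\<close> is the multiple \<open>e\<close> of \<open>d\<close> in \<open>A\<close>.\<close>
  define T where "T = {h \<in> polys_over A. h \<noteq> 0 \<and> (\<exists>e\<in>D. poly h x = e * d)}"
  have "f \<in> T" using f is_subringD(1)[OF D] by (auto simp: T_def intro: bexI[of _ 0])
  then obtain h where h: "h \<in> T" and hmin: "\<And>g. g \<in> T \<Longrightarrow> Polynomial.degree h \<le> Polynomial.degree g"
    using ex_has_least_nat[of "\<lambda>f. f \<in> T" _ Polynomial.degree] by blast
  have hA: "h \<in> polys_over A" "h \<noteq> 0" using h by (auto simp: T_def)
  have h_nonroot: "poly h x \<noteq> 0"
  proof
    assume "poly h x = 0"
    then have deg: "Polynomial.degree f \<le> Polynomial.degree h" using fmin hA by blast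
    obtain j q r where r: "q \<in> polys_over A" "r \<in> polys_over A" "smult (?l ^ j) p = q * f + r"
      "\<And>i. i \<ge> Polynomial.degree f \<Longrightarrow> poly.coeff r i = 0"
      using pseudo_division[OF A is_ideal_self[OF A] f(1) p(1)] by metis
    from arg_cong[OF r(3), of "\<lambda>u. poly u x"] have *: "poly r x = ?l ^ j * d"
      using f p by simp
    then have "r \<noteq> 0" using l d by auto
    moreover have "?l ^ j \<in> D"
      using polyD[of "[:?l ^ j:]"] polys_over_subring(7)[OF A A is_subringD(7)[OF A l(1)]] by simp
    ultimately have "r \<in> T" using r(2) * by (auto simp: T_def)
    then have "Polynomial.degree f \<le> Polynomial.degree r" using hmin deg by force
    with r(4) \<open>r \<noteq> 0\<close> show False by (metis leading_coeff_0_iff)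
  qed
  have "Polynomial.degree h = 0"
  proof -
    obtain j q r where r: "q \<in> polys_over A" "r \<in> polys_over A" "smult (lead_coeff h ^ j) f = q * h + r"
      "\<And>i. i \<ge> Polynomial.degree h \<Longrightarrow> poly.coeff r i = 0"
      using pseudo_division[OF A is_ideal_self[OF A] hA(1) f(1)] by metis
    from arg_cong[OF r(3), of "\<lambda>u. poly u x"] have *: "poly r x = - poly q x * poly h x"
      using f by (simp add: algebra_simps eq_neg_iff_add_eq_0)
    obtain e where e: "e \<in> D" "poly h x = e * d" using h by (auto simp: T_def)
    have "r = 0"
    proof (rule ccontr)
      assume "r \<noteq> 0"
      moreover have "- poly q x * e \<in> D" using polyD[OF r(1)] e is_subringD[OF D] by blast
      ultimately have "r \<in> T" using r(2) * e by (auto simp: T_def mult.assoc intro!: bexI[of _ "- poly q x * e"])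
      with hmin r(4) \<open>r \<noteq> 0\<close> show False by (metis leading_coeff_0_iff)
    qed
    then have eq: "smult (lead_coeff h ^ j) f = q * h" and "poly q x = 0"
      using r(3) * h_nonroot by auto
    have "q \<noteq> 0" using eq f(2) hA(2) by auto
    then have "Polynomial.degree f \<le> Polynomial.degree q" using fmin r(1) \<open>poly q x = 0\<close> by blast
    moreover have "Polynomial.degree f = Polynomial.degree q + Polynomial.degree h"
      using arg_cong[OF eq, of Polynomial.degree] \<open>q \<noteq> 0\<close> hA(2) by (simp add: degree_mult_eq)
    ultimately show ?thesis by simp
  qed
  then obtain e where e: "h = [:e:]" by (rule degree_eq_zeroE)
  obtain d' where d': "d' \<in> D" "e = d' * d" using h e by (auto simp: T_def)
  have eA: "e \<in> A" "e \<noteq> 0" using hA e polys_over_coeff[of h A 0] by auto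
  show ?thesis
  proof (intro bexI[of _ "e * ?l"] conjI allI impI ballI)
    fix I a k u
    assume I: "is_ideal I A" and a: "a \<in> A" and u: "u \<in> polys_over I" and eq: "d ^ k * a = poly u x"
    have "d' ^ k \<in> D" using d' D by (auto intro: is_subringD)
    then obtain v where v: "v \<in> polys_over A" "d' ^ k = poly v x" by (auto simp: D_def)
    obtain j q r where r: "q \<in> polys_over I" "r \<in> polys_over I" "smult (?l ^ j) (v * u) = q * f + r"
      "\<And>i. i \<ge> Polynomial.degree f \<Longrightarrow> poly.coeff r i = 0"
      using pseudo_division[OF A I f(1) polys_over_ideal(4)[OF A I v(1) u]] by metis
    have "poly r x = ?l ^ j * (d' ^ k * (d ^ k * a))"
      using arg_cong[OF r(3), of "\<lambda>u. poly u x"] f eq v by simp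
    also have "\<dots> = ?l ^ j * e ^ k * a" by (simp add: d' power_mult_distrib)
    finally have rx: "poly r x = ?l ^ j * e ^ k * a" .
    let ?c = "?l ^ j * e ^ k * a"
    have cA: "?c \<in> A" using l(1) eA(1) a by (intro is_subringD[OF A])
    have "Polynomial.degree f \<noteq> 0"
      using f(2,3) by (metis degree_eq_zeroE mult_zero_right pCons_0_0 poly_0 poly_pCons add.right_neutral)
    then have "r - [:?c:] = 0"
      using rx r(4) polys_over_mono[OF is_idealD(1)[OF I]] r(2)
      by (intro small polys_over_subring[OF A A] cA) (auto simp: coeff_pCons split: nat.splits)
    then have "?c = poly.coeff r 0" by simp
    then have "?c \<in> I" using polys_over_coeff[OF r(2)] by metis
    \<comment> \<open>The exponents of \<open>l\<close> and \<open>e\<close> are made equal, so that a power of the single element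
      \<open>e l\<close> appears.\<close>
    moreover have "?l ^ k * e ^ j \<in> A" using l(1) eA(1) by (intro is_subringD[OF A])
    ultimately have "?l ^ k * e ^ j * ?c \<in> I"
      by (rule is_idealD(4)[OF I, rotated])
    also have "?l ^ k * e ^ j * ?c = (e * ?l) ^ (j + k) * a"
      by (simp add: power_mult_distrib power_add mult_ac)
    finally show "\<exists>m. (e * ?l) ^ m * a \<in> I" by blast
  qed (use l eA in \<open>auto intro: is_subringD[OF A]\<close>)
qed

text \<open>
  The elements are adjoined one at a time. The denominator needed for the last one becomes the element
  \<open>d\<close> to be inverted in the step before, and this is why the step allows an arbitrary \<open>d\<close>.
\<close>

lemma generic_freeness:
  fixes A :: "'a::idom set"
  assumes A: "is_subring A" and d: "d \<in> adjoin A xs" "d \<noteq> 0"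
  shows "\<exists>c\<in>A. c \<noteq> 0 \<and> (\<forall>I. is_ideal I A \<longrightarrow> (\<forall>a\<in>A. \<forall>k.
    d ^ k * a \<in> adjoin I xs \<longrightarrow> (\<exists>m. c ^ m * a \<in> I)))"
  using d
proof (induction xs arbitrary: d)
  case Nil
  then show ?case by auto
next
  case (Cons x xs)
  let ?A = "adjoin A xs"
  have A': "is_subring ?A" by (rule is_subring_adjoin[OF A])
  obtain c where c: "c \<in> ?A" "c \<noteq> 0" and cstep: "\<And>I a k u. is_ideal I ?A \<Longrightarrow> a \<in> ?A \<Longrightarrow> u \<in> polys_over I \<Longrightarrow>
      d ^ k * a = poly u x \<Longrightarrow> \<exists>m. c ^ m * a \<in> I"
    using generic_freeness_step[OF A', of d x] Cons.prems by auto
  obtain c' where c': "c' \<in> A" "c' \<noteq> 0" and step': "\<And>I a k. is_ideal I A \<Longrightarrow> a \<in> A \<Longrightarrow>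
      c ^ k * a \<in> adjoin I xs \<Longrightarrow> \<exists>m. c' ^ m * a \<in> I"
    using Cons.IH[OF c] by blast
  have "\<exists>m. c' ^ m * a \<in> I" if I: "is_ideal I A" and a: "a \<in> A" and da: "d ^ k * a \<in> adjoin I (x # xs)" for I a k
  proof -
    obtain u where "u \<in> polys_over (adjoin I xs)" "d ^ k * a = poly u x" using da by auto
    then show ?thesis
      using cstep[OF is_ideal_adjoin[OF A I, of xs]] step'[OF I a] a
        adjoin_base[OF is_subringD(1)[OF A], of xs] by (meson subsetD)
  qed
  then show ?case using c' by blast
qed

section \<open>Prime ideals and the boundary monoid\<close>

text \<open>
  An ideal that is maximal among those containing \<open>J\<close> and disjoint from \<open>S\<close> is prime: if it contained
  neither \<open>a\<close> nor \<open>b\<close>, enlarging it by either would reach \<open>S\<close>, and the product of the two elements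
  reached would lie in \<open>S\<close> and, if \<open>a b\<close> is in the ideal, also in the ideal.
\<close>

lemma prime_avoiding_monoid:
  fixes B :: "'a::comm_ring_1 set"
  assumes B: "is_subring B" and J: "is_ideal J B" and S: "1 \<in> S" "\<And>a b. a \<in> S \<Longrightarrow> b \<in> S \<Longrightarrow> a * b \<in> S"
    and disj: "J \<inter> S = {}"
  obtains P where "is_prime P B" "J \<subseteq> P" "P \<inter> S = {}"
proof -
  define \<F> where "\<F> = {I. is_ideal I B \<and> J \<subseteq> I \<and> I \<inter> S = {}}"
  have "\<exists>M\<in>\<F>. \<forall>X\<in>\<F>. M \<subseteq> X \<longrightarrow> X = M"
  proof (rule subset_Zorn_nonempty)
    show "\<F> \<noteq> {}" using J disj by (auto simp: \<F>_def)
    fix \<C> assume ne: "\<C> \<noteq> {}" and ch: "subset.chain \<F> \<C>"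
    have sub: "\<C> \<subseteq> \<F>" and tot: "\<And>X Y. X \<in> \<C> \<Longrightarrow> Y \<in> \<C> \<Longrightarrow> X \<subseteq> Y \<or> Y \<subseteq> X"
      using ch by (auto simp: subset_chain_def)
    have id: "is_ideal X B" if "X \<in> \<C>" for X using that sub by (auto simp: \<F>_def)
    have "is_ideal (\<Union>\<C>) B"
      unfolding is_ideal_def
    proof (intro conjI ballI)
      show "\<Union>\<C> \<subseteq> B" using is_idealD(1)[OF id] by blast
      show "0 \<in> \<Union>\<C>" using ne is_idealD(2)[OF id] by blast
    next
      fix a b assume "a \<in> \<Union>\<C>" "b \<in> \<Union>\<C>"
      then obtain X where "X \<in> \<C>" "a \<in> X" "b \<in> X" using tot by blast
      then show "a + b \<in> \<Union>\<C>" using is_idealD(3)[OF id] by blast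
    next
      fix a b assume "a \<in> B" "b \<in> \<Union>\<C>"
      then show "a * b \<in> \<Union>\<C>" using is_idealD(4)[OF id] by blast
    qed
    then show "\<Union>\<C> \<in> \<F>" using sub ne by (auto simp: \<F>_def)
  qed
  then obtain P where P: "is_ideal P B" "J \<subseteq> P" "P \<inter> S = {}"
    and max: "\<And>X. is_ideal X B \<Longrightarrow> X \<inter> S = {} \<Longrightarrow> P \<subseteq> X \<Longrightarrow> X = P"
    by (auto simp: \<F>_def)
  have meet: "\<exists>p\<in>P. \<exists>b\<in>B. p + a * b \<in> S" if a: "a \<in> B" "a \<notin> P" for a
  proof (rule ccontr)
    assume no: "\<not> ?thesis"
    define X where "X = {p + a * b | p b. p \<in> P \<and> b \<in> B}"
    have "is_ideal X B"
      unfolding is_ideal_def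
    proof (intro conjI ballI)
      show "X \<subseteq> B" using is_idealD(1)[OF P(1)] a by (auto simp: X_def intro!: is_subringD[OF B])
      have "0 + a * 0 \<in> X" unfolding X_def using is_idealD(2)[OF P(1)] is_subringD(1)[OF B] by blast
      then show "0 \<in> X" by simp
    next
      fix u v assume "u \<in> X" "v \<in> X"
      then obtain p b p' b' where *: "p \<in> P" "b \<in> B" "u = p + a * b" "p' \<in> P" "b' \<in> B" "v = p' + a * b'"
        by (auto simp: X_def)
      then have "u + v = (p + p') + a * (b + b')" by (simp add: algebra_simps)
      then show "u + v \<in> X" unfolding X_def
        using is_idealD(3)[OF P(1)] is_subringD(4)[OF B] * by blast
    next
      fix u v assume "u \<in> B" "v \<in> X"
      then obtain p b where *: "p \<in> P" "b \<in> B" "v = p + a * b"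
        by (auto simp: X_def)
      then have "u * v = (u * p) + a * (u * b)" by (simp add: algebra_simps)
      then show "u * v \<in> X" unfolding X_def
        using is_idealD(4)[OF P(1)] is_subringD(5)[OF B] * \<open>u \<in> B\<close> by blast
    qed
    moreover have "X \<inter> S = {}" using no by (auto simp: X_def)
    moreover have "P \<subseteq> X"
    proof
      fix p assume "p \<in> P"
      then have "p + a * 0 \<in> X" unfolding X_def using is_subringD(1)[OF B] by blast
      then show "p \<in> X" by simp
    qed
    ultimately have "X = P" using max by blast
    moreover have "0 + a * 1 \<in> X" unfolding X_def using is_idealD(2)[OF P(1)] is_subringD(2)[OF B] by blast
    ultimately show False using a by simp
  qed
  have "a \<in> P \<or> b \<in> P" if ab: "a \<in> B" "b \<in> B" "a * b \<in> P" for a b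
  proof (rule ccontr)
    assume "\<not> ?thesis"
    then obtain p b1 q b2 where *: "p \<in> P" "b1 \<in> B" "p + a * b1 \<in> S" "q \<in> P" "b2 \<in> B" "q + b * b2 \<in> S"
      using meet ab by metis
    have PB: "P \<subseteq> B" by (rule is_idealD(1)[OF P(1)])
    have eq: "(p + a * b1) * (q + b * b2) = (q + b * b2) * p + (a * b1) * q + (b1 * b2) * (a * b)"
      by (simp add: algebra_simps)
    have "q + b * b2 \<in> B" "a * b1 \<in> B" "b1 * b2 \<in> B"
      using * ab PB by (auto intro!: is_subringD[OF B])
    then have "(p + a * b1) * (q + b * b2) \<in> P"
      unfolding eq using * ab by (auto intro!: is_idealD(3,4)[OF P(1)])
    then show False using S(2)[OF *(3,6)] P(3) by blast
  qed
  then have "is_prime P B" using P S(1) by (auto simp: is_prime_def)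
  with P that show ?thesis by blast
qed

text \<open>
  The iterated boundary monoid of Coquand and Lombardi. Their theorem characterizes Krull dimension
  without prime ideals: \<open>A\<close> has a chain of primes of length \<open>d\<close> iff for some \<open>w_1, ..., w_d\<close> the monoid built
  from \<open>M = {1}\<close> does not contain 0. The starting monoid is a parameter because the powers of a
  denominator \<open>c\<close> serve as \<open>M\<close> when working in \<open>A[1/c]\<close>.
\<close>

fun boundary_monoid :: "'a::comm_ring_1 set \<Rightarrow> 'a set \<Rightarrow> 'a list \<Rightarrow> 'a set" where
  "boundary_monoid A M [] = M"
| "boundary_monoid A M (w # ws) = {w ^ n * (s + w * a) | n s a. s \<in> boundary_monoid A M ws \<and> a \<in> A}"

lemma boundary_monoid_subset:
  assumes B: "is_subring B" and "set ws \<subseteq> B" "M \<subseteq> B"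
  shows "boundary_monoid B M ws \<subseteq> B"
  using assms(2) by (induction ws) (use assms in \<open>auto intro!: is_subringD[OF B]\<close>)

lemma boundary_monoid_monoid:
  assumes B: "is_subring B" and ws: "set ws \<subseteq> B"
  shows "1 \<in> boundary_monoid B {1} ws"
    and "a \<in> boundary_monoid B {1} ws \<Longrightarrow> b \<in> boundary_monoid B {1} ws \<Longrightarrow> a * b \<in> boundary_monoid B {1} ws"
proof -
  show "1 \<in> boundary_monoid B {1} ws"
  proof (induction ws)
    case (Cons w ws)
    have "1 = w ^ 0 * (1 + w * 0)" by simp
    then show ?case using Cons is_subringD(1)[OF B] unfolding boundary_monoid.simps by blast
  qed simp
  show "a \<in> boundary_monoid B {1} ws \<Longrightarrow> b \<in> boundary_monoid B {1} ws \<Longrightarrow> a * b \<in> boundary_monoid B {1} ws"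
    using ws
  proof (induction ws arbitrary: a b)
    case (Cons w ws)
    let ?M = "boundary_monoid B {1} ws"
    obtain n s x where a: "a = w ^ n * (s + w * x)" "s \<in> ?M" "x \<in> B" using Cons.prems by auto
    obtain m t y where b: "b = w ^ m * (t + w * y)" "t \<in> ?M" "y \<in> B" using Cons.prems by auto
    have "?M \<subseteq> B" using boundary_monoid_subset[OF B, of ws "{1}"] is_subringD(2)[OF B] Cons.prems by auto
    then have "s * y + t * x + w * x * y \<in> B"
      using a b Cons.prems by (auto intro!: is_subringD[OF B])
    moreover have "a * b = w ^ (n + m) * (s * t + w * (s * y + t * x + w * x * y))"
      unfolding a b by (simp add: algebra_simps power_add)
    ultimately show ?case using Cons.IH[OF a(2) b(2)] Cons.prems by auto
  qed auto
qed

text \<open>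
  A prime \<open>P\<close> that avoids the monoid of \<open>w, ws\<close> does not contain \<open>w\<close>, while \<open>P + w B\<close> avoids the monoid of
  \<open>ws\<close>: from \<open>p + w b = s\<close> one would get \<open>s - w b = p\<close>, an element of \<open>P\<close> and of the monoid of \<open>w, ws\<close>.
  So the rest of the chain can be built above \<open>P + w B\<close>, strictly above \<open>P\<close>.
\<close>

lemma prime_chain_from_boundary:
  fixes B :: "'a::comm_ring_1 set"
  assumes B: "is_subring B"
  shows "set ws \<subseteq> B \<Longrightarrow> is_ideal J B \<Longrightarrow> J \<inter> boundary_monoid B {1} ws = {} \<Longrightarrow>
    \<exists>P :: nat \<Rightarrow> 'a set. (\<forall>i\<le>length ws. is_prime (P i) B) \<and> (\<forall>i<length ws. P i \<subset> P (Suc i)) \<and> J \<subseteq> P 0"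
proof (induction ws arbitrary: J)
  case Nil
  then obtain P where "is_prime P B" "J \<subseteq> P"
    using prime_avoiding_monoid[OF B Nil(2), of "{1}"] by auto
  then show ?case by (intro exI[of _ "\<lambda>_. P"]) auto
next
  case (Cons w ws)
  let ?M = "boundary_monoid B {1} ws"
  have w: "w \<in> B" "set ws \<subseteq> B" using Cons.prems by auto
  obtain P0 where P0: "is_prime P0 B" "J \<subseteq> P0" "P0 \<inter> boundary_monoid B {1} (w # ws) = {}"
    using prime_avoiding_monoid[OF B Cons.prems(2) boundary_monoid_monoid[OF B Cons.prems(1)] Cons.prems(3)]
    by blast
  have P0i: "is_ideal P0 B" using P0 by (simp add: is_prime_def)
  have one: "1 \<in> ?M" by (rule boundary_monoid_monoid[OF B w(2)])
  define X where "X = {p + w * b | p b. p \<in> P0 \<and> b \<in> B}"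
  have wb: "p + w * b \<in> X" if "p \<in> P0" "b \<in> B" for p b using that unfolding X_def by blast
  have "w ^ 1 * (1 + w * 0) \<in> boundary_monoid B {1} (w # ws)"
    using one is_subringD(1)[OF B] unfolding boundary_monoid.simps by blast
  then have "w \<notin> P0" using P0(3) by auto
  have X: "is_ideal X B"
    unfolding is_ideal_def
  proof (intro conjI ballI)
    show "X \<subseteq> B" using is_idealD(1)[OF P0i] w by (auto simp: X_def intro!: is_subringD[OF B])
    show "0 \<in> X" using wb[OF is_idealD(2)[OF P0i] is_subringD(1)[OF B]] by simp
  next
    fix u v assume "u \<in> X" "v \<in> X"
    then obtain p b p' b' where *: "p \<in> P0" "b \<in> B" "u = p + w * b" "p' \<in> P0" "b' \<in> B" "v = p' + w * b'"
      by (auto simp: X_def)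
    then have "u + v = (p + p') + w * (b + b')" by (simp add: algebra_simps)
    then show "u + v \<in> X"
      using wb[OF is_idealD(3)[OF P0i *(1,4)] is_subringD(4)[OF B *(2,5)]] by simp
  next
    fix u v assume "u \<in> B" "v \<in> X"
    then obtain p b where *: "p \<in> P0" "b \<in> B" "v = p + w * b"
      by (auto simp: X_def)
    then have "u * v = (u * p) + w * (u * b)" by (simp add: algebra_simps)
    then show "u * v \<in> X"
      using wb[OF is_idealD(4)[OF P0i \<open>u \<in> B\<close> *(1)] is_subringD(5)[OF B \<open>u \<in> B\<close> *(2)]] by simp
  qed
  have "X \<inter> ?M = {}"
  proof (rule ccontr)
    assume "X \<inter> ?M \<noteq> {}"
    then obtain p b where *: "p \<in> P0" "b \<in> B" "p + w * b \<in> ?M" by (auto simp: X_def)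
    have "p = w ^ 0 * ((p + w * b) + w * (- b))" by (simp add: algebra_simps)
    moreover have "- b \<in> B" using * is_subringD[OF B] by blast
    ultimately have "p \<in> boundary_monoid B {1} (w # ws)"
      using *(3) unfolding boundary_monoid.simps by blast
    with P0(3) * show False by blast
  qed
  then obtain P where P: "\<forall>i\<le>length ws. is_prime (P i) B" "\<forall>i<length ws. P i \<subset> P (Suc i)" "X \<subseteq> P 0"
    using Cons.IH[OF w(2) X] by blast
  have "P0 \<subseteq> X" using wb[OF _ is_subringD(1)[OF B]] by auto
  moreover have "w \<in> X" using wb[OF is_idealD(2)[OF P0i] is_subringD(2)[OF B]] by simp
  ultimately have "P0 \<subset> P 0" using P(3) \<open>w \<notin> P0\<close> by blast
  with P P0 show ?case
    by (intro exI[of _ "case_nat P0 P"]) (auto split: nat.splits simp: less_Suc_eq_0_disj)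
qed

section \<open>Algebraic independence\<close>

text \<open>
  Independence is expressed one variable at a time, each element being transcendental over the ring
  generated by those after it; this avoids polynomials in several indeterminates.
\<close>

fun alg_indep :: "'a::comm_ring_1 set \<Rightarrow> 'a list \<Rightarrow> bool" where
  "alg_indep K [] \<longleftrightarrow> True"
| "alg_indep K (z # zs) \<longleftrightarrow> alg_indep K zs \<and> (\<forall>p\<in>polys_over (adjoin K zs). poly p z = 0 \<longrightarrow> p = 0)"

text \<open>
  Given \<open>zs\<close> independent modulo \<open>P_1\<close>, any \<open>z\<close> in \<open>P_1\<close> but not in \<open>P_0\<close> can be added: in a relation
  \<open>c + z p(z)\<close> modulo \<open>P_0\<close> the constant term \<open>c\<close> lies in \<open>P_1\<close> and hence vanishes, and \<open>z\<close> can then be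
  cancelled modulo \<open>P_0\<close>.
\<close>

lemma alg_indep_from_prime_chain:
  fixes A :: "'a::comm_ring_1 set"
  assumes A: "is_subring A" and K: "is_subfield K" "K \<subseteq> A"
  shows "\<forall>i\<le>d. is_prime (P i) A \<Longrightarrow> \<forall>i<d. P i \<subset> P (Suc i) \<Longrightarrow>
    \<exists>zs. length zs = d \<and> set zs \<subseteq> A \<and> alg_indep K zs \<and> adjoin K zs \<inter> P 0 = {0}"
proof (induction d arbitrary: P)
  case 0
  then have P: "is_prime (P 0) A" by simp
  have "a = 0" if a: "a \<in> K" "a \<in> P 0" for a
  proof (rule ccontr)
    assume "a \<noteq> 0"
    then obtain b where "b \<in> K" "a * b = 1" using K a by (auto simp: is_subfield_def)
    then have "1 \<in> P 0" using P a K is_idealD(5)[of "P 0" A b a] by (auto simp: is_prime_def)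
    then show False using P by (simp add: is_prime_def)
  qed
  then show ?case
    using K P by (auto simp: is_subfield_def is_prime_def is_idealD is_subringD)
next
  case (Suc d)
  have Ks: "is_subring K" using K by (simp add: is_subfield_def)
  obtain zs where zs: "length zs = d" "set zs \<subseteq> A" "alg_indep K zs" "adjoin K zs \<inter> P 1 = {0}"
    using Suc.IH[of "\<lambda>i. P (Suc i)"] Suc.prems by auto
  let ?C = "adjoin K zs"
  have C: "is_subring ?C" by (rule is_subring_adjoin[OF Ks])
  have CA: "?C \<subseteq> A" using adjoin_least[OF A is_subringD(1)[OF Ks] K(2) zs(2)] .
  have P0: "is_prime (P 0) A" and P1: "is_prime (P 1) A" and P01: "P 0 \<subset> P 1" using Suc.prems by auto
  then have P0i: "is_ideal (P 0) A" and P1i: "is_ideal (P 1) A" by (auto simp: is_prime_def)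
  obtain z where z: "z \<in> P 1" "z \<notin> P 0" using P01 by blast
  have zA: "z \<in> A" using z is_idealD[OF P1i] by blast
  have pA: "poly p z \<in> A" if "p \<in> polys_over ?C" for p
    using that is_subringD(1)[OF C]
    by (induction p rule: polys_over_induct) (use CA zA in \<open>auto intro!: is_subringD[OF A]\<close>)
  have key: "poly p z \<in> P 0 \<longrightarrow> p = 0" if "p \<in> polys_over ?C" for p
    using that is_subringD(1)[OF C]
  proof (induction p rule: polys_over_induct)
    case (pCons c p)
    show ?case
    proof
      assume *: "poly (pCons c p) z \<in> P 0"
      have "(c + z * poly p z) - z * poly p z \<in> P 1"
        using * P01 is_idealD(5)[OF P1i pA[OF pCons(2)] z(1)] by (intro is_ideal_diff[OF A P1i]) auto
      then have "c = 0" using pCons(1) zs(4) by auto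
      then have "z * poly p z \<in> P 0" using * by simp
      then have "poly p z \<in> P 0" using P0 z pA[OF pCons(2)] zA by (auto simp: is_prime_def)
      then show "pCons c p = 0" using \<open>c = 0\<close> pCons by simp
    qed
  qed auto
  have "alg_indep K (z # zs)" using zs(3) key is_idealD(2)[OF P0i] by auto
  moreover have "adjoin K (z # zs) \<inter> P 0 = {0}"
    using key is_idealD(2)[OF P0i] is_subringD(1)[OF is_subring_adjoin[OF Ks, of "z # zs"]] by fastforce
  ultimately show ?case
    using zs zA by (intro exI[of _ "z # zs"]) auto
qed

lemma poly_diff_factor:
  fixes p :: "'a::comm_ring_1 poly"
  assumes C: "is_subring C" and p: "p \<in> polys_over C" and l: "l \<in> C"
  obtains q where "q \<in> polys_over C" "\<And>z. poly p z - poly p l = (z - l) * poly q z"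
proof -
  have "\<exists>q\<in>polys_over C. \<forall>z. poly p z - poly p l = (z - l) * poly q z"
    using p is_subringD(1)[OF C]
  proof (induction p rule: polys_over_induct)
    case zero
    then show ?case using polys_over_subring(1)[OF C C] by (intro bexI[of _ 0]) auto
  next
    case (pCons a p)
    then obtain q where q: "q \<in> polys_over C" "\<And>z. poly p z - poly p l = (z - l) * poly q z" by blast
    have "poly (pCons a p) z - poly (pCons a p) l = (z - l) * poly (p + smult l q) z" for z
    proof -
      have "poly (pCons a p) z - poly (pCons a p) l = (z - l) * poly p z + l * (poly p z - poly p l)"
        by (simp add: algebra_simps)
      then show ?thesis unfolding q(2) by (simp add: algebra_simps)
    qed
    then show ?case
      using polys_over_subring(2)[OF C C pCons(2) polys_over_subring(5)[OF C C l q(1)]] by blast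
  qed
  then show ?thesis using that by blast
qed

text \<open>
  Reduction modulo \<open>w\<close>, written without a quotient: \<open>C\<close> contains representatives of \<open>A\<close> modulo \<open>w\<close>, and
  elements of the monoid over \<open>A\<close> reduce to elements of the monoid over \<open>C\<close>.
\<close>

lemma boundary_monoid_specialize:
  fixes A C :: "'a::comm_ring_1 set"
  assumes C: "is_subring C" "C \<subseteq> A" and A: "is_subring A" and w: "w \<in> A"
    and dec: "\<And>a. a \<in> A \<Longrightarrow> \<exists>a'\<in>C. \<exists>b\<in>A. a = a' + w * b"
    and c: "c = c' + w * b0" "c' \<in> C" "b0 \<in> A"
  shows "set ws \<subseteq> C \<Longrightarrow> s \<in> boundary_monoid A (range ((^) c)) ws \<Longrightarrow>
    \<exists>s'\<in>boundary_monoid C (range ((^) c')) ws. \<exists>b\<in>A. s = s' + w * b"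
proof (induction ws arbitrary: s)
  case Nil
  then obtain n where s: "s = c ^ n" by auto
  have "\<exists>b\<in>A. c ^ n = c' ^ n + w * b"
  proof (induction n)
    case 0
    then show ?case using is_subringD(1)[OF A] by (intro bexI[of _ 0]) auto
  next
    case (Suc n)
    then obtain b where b: "b \<in> A" "c ^ n = c' ^ n + w * b" by blast
    have "c ^ Suc n = c' ^ Suc n + w * (b0 * c' ^ n + c * b)"
      by (simp add: b(2)) (simp add: c(1) algebra_simps)
    moreover have "b0 * c' ^ n + c * b \<in> A"
      using b c C(2) w by (auto intro!: is_subringD[OF A])
    ultimately show ?case by blast
  qed
  then show ?case by (auto simp: s)
next
  case (Cons v ws)
  obtain n t a where s: "s = v ^ n * (t + v * a)" "t \<in> boundary_monoid A (range ((^) c)) ws" "a \<in> A"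
    using Cons.prems by auto
  obtain t' b where t: "t' \<in> boundary_monoid C (range ((^) c')) ws" "b \<in> A" "t = t' + w * b"
    using Cons.IH[OF _ s(2)] Cons.prems by auto
  obtain a' b' where a: "a' \<in> C" "b' \<in> A" "a = a' + w * b'" using dec[OF s(3)] by blast
  have "s = v ^ n * (t' + v * a') + w * (v ^ n * (b + v * b'))"
    unfolding s t(3) a(3) by (simp add: algebra_simps)
  moreover have "v ^ n * (t' + v * a') \<in> boundary_monoid C (range ((^) c')) (v # ws)"
    using t(1) a(1) by auto
  moreover have "v ^ n * (b + v * b') \<in> A"
    using Cons.prems C(2) t a by (auto intro!: is_subringD[OF A])
  ultimately show ?case by blast
qed

text \<open>
  The \<open>ws\<close> are \<open>z_i - l_i\<close> with \<open>l_i\<close> in \<open>K\<close> such that the polynomial \<open>c\<close> does not vanish at \<open>(l_1, ..., l_d)\<close>;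
  such a point exists because \<open>K\<close> is infinite. They form a regular sequence in the polynomial
  ring \<open>K[zs]\<close>, and \<open>c\<close> is invertible modulo it, so the monoid cannot contain 0. In the induction,
  \<open>w^n (s + w a) = 0\<close> gives \<open>s\<close> divisible by \<open>w\<close>, and evaluation at \<open>z = l\<close> produces 0 in the monoid of
  the remaining variables.
\<close>

lemma boundary_of_shifted_variables:
  fixes K :: "'a::idom set"
  assumes K: "is_subring K" "infinite K"
  shows "alg_indep K zs \<Longrightarrow> c \<in> adjoin K zs \<Longrightarrow> c \<noteq> 0 \<Longrightarrow>
    \<exists>ws. length ws = length zs \<and> set ws \<subseteq> adjoin K zs
      \<and> 0 \<notin> boundary_monoid (adjoin K zs) (range ((^) c)) ws"
proof (induction zs arbitrary: c)
  case Nil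
  then show ?case by auto
next
  case (Cons z zs)
  let ?C = "adjoin K zs" and ?A = "adjoin K (z # zs)"
  have C: "is_subring ?C" and A: "is_subring ?A" by (rule is_subring_adjoin[OF K(1)])+
  have CA: "?C \<subseteq> ?A" using adjoin_base[of ?C "[z]"] is_subringD(1)[OF C] by simp
  have KC: "K \<subseteq> ?C" by (rule adjoin_base[OF is_subringD(1)[OF K(1)]])
  have zA: "z \<in> ?A" using adjoin_elements[OF K(1), of "z # zs"] by auto
  have trans: "p = 0" if "p \<in> polys_over ?C" "poly p z = 0" for p using Cons.prems that by auto
  obtain p where p: "p \<in> polys_over ?C" "c = poly p z" using Cons.prems by auto
  have "p \<noteq> 0" using p Cons.prems by auto
  then have "\<exists>l\<in>K. poly p l \<noteq> 0"
    using poly_roots_finite[of p] K(2) by (metis (mono_tags, lifting) mem_Collect_eq rev_finite_subset subsetI)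
  then obtain l where l: "l \<in> K" "poly p l \<noteq> 0" by blast
  have lC: "l \<in> ?C" using l KC by blast
  define w where "w = z - l"
  have evC: "poly q l \<in> ?C" if "q \<in> polys_over ?C" for q
    using that is_subringD(1)[OF C]
    by (induction q rule: polys_over_induct) (use lC in \<open>auto intro!: is_subringD[OF C]\<close>)
  have dec: "\<exists>q'\<in>polys_over ?C. poly q z = poly q l + w * poly q' z" if "q \<in> polys_over ?C" for q
    using poly_diff_factor[OF C that lC] unfolding w_def by (metis add.commute diff_add_cancel)
  have wA: "w \<in> ?A" unfolding w_def using zA lC CA by (intro is_subringD[OF A]) auto
  have wq: "s = 0" if s: "s \<in> ?C" "s = w * b" "b \<in> ?A" for s b
  proof -
    obtain q where q: "q \<in> polys_over ?C" "b = poly q z" using s by auto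
    let ?q = "[:-l, 1:] * q - [:s:]"
    have "[:-l, 1:] \<in> polys_over ?C"
      using lC is_subringD[OF C] by (simp add: polys_over_pCons polys_over_subring[OF C C])
    then have "?q \<in> polys_over ?C" using q s by (intro polys_over_subring[OF C C])
    moreover have "poly ?q z = 0" using s q by (simp add: w_def algebra_simps)
    ultimately have "?q = 0" by (rule trans)
    from arg_cong[OF this, of "\<lambda>q. poly q l"] show ?thesis by simp
  qed
  have "w \<noteq> 0"
  proof
    assume "w = 0"
    then have "(1::'a) = 0" using wq[of 1 0] trans[of "[:-l,1:]"] lC is_subringD[OF C]
      by (auto simp: w_def polys_over_pCons polys_over_subring[OF C C])
    then show False by simp
  qed
  obtain ws where ws: "length ws = length zs" "set ws \<subseteq> ?C"
    "0 \<notin> boundary_monoid ?C (range ((^) (poly p l))) ws"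
    using Cons.IH[of "poly p l"] Cons.prems evC[OF p(1)] l by auto
  have "0 \<notin> boundary_monoid ?A (range ((^) c)) (w # ws)"
  proof
    assume "0 \<in> boundary_monoid ?A (range ((^) c)) (w # ws)"
    then obtain n s a where *: "0 = w ^ n * (s + w * a)" "s \<in> boundary_monoid ?A (range ((^) c)) ws" "a \<in> ?A"
      by (auto simp del: adjoin.simps)
    then have s: "s = - (w * a)" using \<open>w \<noteq> 0\<close> by (simp add: eq_neg_iff_add_eq_0)
    obtain p' where p': "p' \<in> polys_over ?C" "poly p z = poly p l + w * poly p' z" using dec[OF p(1)] by blast
    have p'A: "poly p' z \<in> ?A" using p' by auto
    have decA: "\<exists>a'\<in>?C. \<exists>b\<in>?A. a = a' + w * b" if a: "a \<in> ?A" for a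
    proof -
      obtain q where "q \<in> polys_over ?C" "a = poly q z" using a by auto
      then show ?thesis using dec[of q] evC[of q] by auto
    qed
    obtain s' b where s': "s' \<in> boundary_monoid ?C (range ((^) (poly p l))) ws" "b \<in> ?A" "s = s' + w * b"
      using boundary_monoid_specialize[OF C CA A wA decA p'(2)[folded p(2)] evC[OF p(1)] p'A ws(2) *(2)] by blast
    have "range ((^) (poly p l)) \<subseteq> ?C" using is_subringD(7)[OF C evC[OF p(1)]] by auto
    then have "s' \<in> ?C" using boundary_monoid_subset[OF C ws(2)] s'(1) by blast
    moreover have "s' = w * (- a - b)" using s s' by (simp add: algebra_simps)
    moreover have "- a - b \<in> ?A" using *(3) s'(2) by (intro is_subringD[OF A])
    ultimately have "s' = 0" by (rule wq)
    with s' ws show False by simp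
  qed
  then show ?case using ws CA wA by (intro exI[of _ "w # ws"]) (auto simp del: adjoin.simps)
qed

text \<open>
  An equation \<open>0 = s\<close> with \<open>s\<close> in the monoid over \<open>B = A[xs]\<close> is a statement of ideal membership: expanding
  \<open>s\<close> gives \<open>a\<close>, the product of the powers of the \<open>ws\<close>, plus a combination with coefficients in \<open>B\<close> of
  products lying in \<open>A\<close>. The ideal \<open>I\<close> of \<open>A\<close> is generated by those products, and the last conjunct says
  that the same expressions with coefficients in \<open>A\<close> form elements of the monoid over \<open>A\<close>.
\<close>

lemma boundary_monoid_descent:
  fixes A :: "'a::idom set"
  assumes A: "is_subring A"
  shows "set ws \<subseteq> A \<Longrightarrow> s \<in> boundary_monoid (adjoin A xs) {1} ws \<Longrightarrow>
    \<exists>I a. is_ideal I A \<and> a \<in> A \<and> s - a \<in> adjoin I xs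
      \<and> (\<forall>m. \<forall>y\<in>I. c ^ m * a + y \<in> boundary_monoid A (range ((^) c)) ws)"
proof (induction ws arbitrary: s)
  case Nil
  have "is_ideal {0} A" using is_subringD(1)[OF A] by (simp add: is_ideal_def)
  then show ?case
    using Nil is_subringD(2)[OF A] adjoin_base[of "{0}" xs] by (intro exI[of _ "{0}"] exI[of _ 1]) auto
next
  case (Cons w ws)
  let ?B = "adjoin A xs"
  have w: "w \<in> A" using Cons.prems by simp
  obtain n t b where s: "s = w ^ n * (t + w * b)" "t \<in> boundary_monoid ?B {1} ws" "b \<in> ?B"
    using Cons.prems by auto
  obtain I a where I: "is_ideal I A" "a \<in> A" "t - a \<in> adjoin I xs"
      "\<And>m y. y \<in> I \<Longrightarrow> c ^ m * a + y \<in> boundary_monoid A (range ((^) c)) ws"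
    using Cons.IH[OF _ s(2)] Cons.prems by auto
  define I' where "I' = {w ^ n * (y + w * b) | y b. y \<in> I \<and> b \<in> A}"
  have I'I: "w ^ n * (y + w * b) \<in> I'" if "y \<in> I" "b \<in> A" for y b using that by (auto simp: I'_def)
  have I': "is_ideal I' A"
    unfolding is_ideal_def
  proof (intro conjI ballI)
    show "I' \<subseteq> A" using is_idealD(1)[OF I(1)] w by (auto simp: I'_def intro!: is_subringD[OF A])
    show "0 \<in> I'" using I'I[OF is_idealD(2)[OF I(1)] is_subringD(1)[OF A]] by simp
  next
    fix u v assume "u \<in> I'" "v \<in> I'"
    then obtain y b y' b' where *: "y \<in> I" "b \<in> A" "u = w ^ n * (y + w * b)"
      "y' \<in> I" "b' \<in> A" "v = w ^ n * (y' + w * b')" by (auto simp: I'_def)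
    then have "u + v = w ^ n * ((y + y') + w * (b + b'))" by (simp add: algebra_simps)
    then show "u + v \<in> I'"
      using I'I[OF is_idealD(3)[OF I(1) *(1,4)] is_subringD(4)[OF A *(2,5)]] by simp
  next
    fix u v assume "u \<in> A" "v \<in> I'"
    then obtain y b where *: "y \<in> I" "b \<in> A" "v = w ^ n * (y + w * b)" by (auto simp: I'_def)
    then have "u * v = w ^ n * ((u * y) + w * (u * b))" by (simp add: algebra_simps)
    then show "u * v \<in> I'"
      using I'I[OF is_idealD(4)[OF I(1) \<open>u \<in> A\<close> *(1)] is_subringD(5)[OF A \<open>u \<in> A\<close> *(2)]] by simp
  qed
  have "w ^ n * (t - a) \<in> adjoin I' xs"
    using I'I[OF _ is_subringD(1)[OF A]] by (intro adjoin_scale[OF _ I(3)]) simp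
  moreover have "w ^ Suc n * b \<in> adjoin I' xs"
    using I'I[OF is_idealD(2)[OF I(1)]] by (intro adjoin_scale[OF _ s(3)]) (simp add: mult_ac)
  ultimately have "w ^ n * (t - a) + w ^ Suc n * b \<in> adjoin I' xs"
    by (rule is_idealD(3)[OF is_ideal_adjoin[OF A I']])
  moreover have "w ^ n * (t - a) + w ^ Suc n * b = s - w ^ n * a"
    by (simp add: s(1) algebra_simps)
  moreover have "c ^ m * (w ^ n * a) + y \<in> boundary_monoid A (range ((^) c)) (w # ws)" if y: "y \<in> I'" for m y
  proof -
    obtain y1 b1 where *: "y1 \<in> I" "b1 \<in> A" "y = w ^ n * (y1 + w * b1)" using y by (auto simp: I'_def)
    then have "c ^ m * (w ^ n * a) + y = w ^ n * ((c ^ m * a + y1) + w * b1)" by (simp add: algebra_simps)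
    then show ?thesis using I(4)[OF *(1)] *(2) unfolding boundary_monoid.simps by blast
  qed
  moreover have "w ^ n * a \<in> A" using w I(2) by (intro is_subringD[OF A])
  ultimately show ?case using I' by (intro exI[of _ I'] exI[of _ "w ^ n * a"]) auto
qed

text \<open>
  By generic freeness a collapse \<open>0 = a + y\<close> with \<open>a\<close> in \<open>A = K[zs]\<close> and \<open>y\<close> in \<open>I B\<close> descends to
  \<open>c^m a\<close> in \<open>I\<close>, that is, to a collapse over \<open>A[1/c]\<close>; the shifted variables exclude this.
\<close>

lemma prime_chain_from_alg_indep:
  fixes K :: "'a::idom set"
  assumes K: "is_subring K" "infinite K" and zs: "set zs \<subseteq> adjoin K xs" "alg_indep K zs"
  shows "\<exists>P :: nat \<Rightarrow> 'a set. (\<forall>i\<le>length zs. is_prime (P i) (adjoin K xs)) \<and> (\<forall>i<length zs. P i \<subset> P (Suc i))"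
proof -
  let ?A = "adjoin K zs" and ?B = "adjoin K xs"
  have A: "is_subring ?A" and B: "is_subring ?B" by (rule is_subring_adjoin[OF K(1)])+
  have BA: "?B = adjoin ?A xs" using adjoin_absorb[OF K(1) zs(1)] by simp
  have AB: "?A \<subseteq> ?B" unfolding BA by (rule adjoin_base[OF is_subringD(1)[OF A]])
  have one: "1 \<in> adjoin ?A xs" "(1::'a) \<noteq> 0" using is_subringD(2)[OF B] BA by auto
  obtain c where c: "c \<in> ?A" "c \<noteq> 0" and gf: "\<And>I a k. is_ideal I ?A \<Longrightarrow> a \<in> ?A \<Longrightarrow>
      1 ^ k * a \<in> adjoin I xs \<Longrightarrow> \<exists>m. c ^ m * a \<in> I"
    using generic_freeness[OF A one] by blast
  obtain ws where ws: "length ws = length zs" "set ws \<subseteq> ?A" "0 \<notin> boundary_monoid ?A (range ((^) c)) ws"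
    using boundary_of_shifted_variables[OF K zs(2) c] by blast
  have "0 \<notin> boundary_monoid ?B {1} ws"
  proof
    assume "0 \<in> boundary_monoid ?B {1} ws"
    then obtain I a where I: "is_ideal I ?A" "a \<in> ?A" "0 - a \<in> adjoin I xs"
      and mon: "\<And>m y. y \<in> I \<Longrightarrow> c ^ m * a + y \<in> boundary_monoid ?A (range ((^) c)) ws"
      using boundary_monoid_descent[OF A ws(2), of 0 xs c] unfolding BA by blast
    have "- a \<in> ?A" using I(2) by (rule is_subringD(3)[OF A])
    then obtain m where "c ^ m * (- a) \<in> I" using gf[OF I(1), of "- a" 0] I(3) by auto
    from mon[OF this, of m] ws(3) show False by simp
  qed
  moreover have "is_ideal {0} ?B" using is_subringD(1)[OF B] by (simp add: is_ideal_def)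
  ultimately show ?thesis
    using prime_chain_from_boundary[OF B, of ws "{0}"] ws AB by auto
qed

section \<open>Krull dimension of subrings\<close>

definition ring_of :: "'a::comm_ring_1 set \<Rightarrow> 'a ring" where
  "ring_of A = \<lparr>carrier = A, monoid.mult = (*), one = 1, zero = 0, add = (+)\<rparr>"

lemma ring_of_simps [simp]:
  "carrier (ring_of A) = A" "monoid.mult (ring_of A) = (*)" "one (ring_of A) = 1"
  "zero (ring_of A) = 0" "add (ring_of A) = (+)"
  by (simp_all add: ring_of_def)

lemma cring_ring_of:
  assumes "is_subring A"
  shows "cring (ring_of A)"
proof (rule cringI)
  show "abelian_group (ring_of A)"
  proof (rule abelian_groupI)
    fix x assume "x \<in> carrier (ring_of A)"
    then show "\<exists>y\<in>carrier (ring_of A). y \<oplus>\<^bsub>ring_of A\<^esub> x = \<zero>\<^bsub>ring_of A\<^esub>"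
      using is_subringD(3)[OF assms] by (intro bexI[of _ "- x"]) auto
  qed (use is_subringD[OF assms] in auto)
  show "comm_monoid (ring_of A)"
    by (rule comm_monoidI) (use is_subringD[OF assms] in \<open>auto simp: mult_ac\<close>)
qed (auto simp: algebra_simps)

lemma a_inv_ring_of:
  assumes A: "is_subring A" and a: "a \<in> A"
  shows "\<ominus>\<^bsub>ring_of A\<^esub> a = - a"
proof -
  interpret cring "ring_of A" by (rule cring_ring_of[OF A])
  show ?thesis
    using minus_equality[of "- a" a] a is_subringD(3)[OF A] by simp
qed

lemma finsum_ring_of:
  assumes A: "is_subring A" and f: "\<And>i. i \<in> S \<Longrightarrow> f i \<in> A" and S: "finite S"
  shows "finsum (ring_of A) f S = sum f S"
proof -
  interpret cring "ring_of A" by (rule cring_ring_of[OF A])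
  show ?thesis using S f by (induction S) (auto simp: finsum_insert Pi_def)
qed

lemma ideal_ring_of:
  assumes A: "is_subring A"
  shows "ideal I (ring_of A) \<longleftrightarrow> is_ideal I A"
proof
  assume I: "ideal I (ring_of A)"
  then show "is_ideal I A"
    using ideal.axioms(1)[OF I] additive_subgroup.a_subset[of I "ring_of A"]
      additive_subgroup.zero_closed[of I "ring_of A"] additive_subgroup.a_closed[of I "ring_of A"]
      ideal.I_l_closed[OF I]
    by (auto simp: is_ideal_def)
next
  assume I: "is_ideal I A"
  interpret cring "ring_of A" by (rule cring_ring_of[OF A])
  show "ideal I (ring_of A)"
  proof (rule idealI)
    show "subgroup I (add_monoid (ring_of A))"
    proof (rule add.subgroupI)
      fix a assume a: "a \<in> I"
      then show "\<ominus>\<^bsub>ring_of A\<^esub> a \<in> I"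
        using a_inv_ring_of[OF A, of a] is_ideal_diff[OF A I is_idealD(2)[OF I] a] is_idealD(1)[OF I] by auto
    qed (use is_idealD[OF I] in auto)
  qed (use is_idealD[OF I] ring_axioms in auto)
qed

lemma primeideal_ring_of:
  assumes A: "is_subring A"
  shows "primeideal P (ring_of A) \<longleftrightarrow> is_prime P A"
proof
  assume P: "primeideal P (ring_of A)"
  then have I: "is_ideal P A" using ideal_ring_of[OF A] by (simp add: primeideal_def)
  have "1 \<notin> P"
    using primeideal.I_notcarr[OF P] is_idealD(1)[OF I] is_idealD(4)[OF I, of _ 1] by auto
  then show "is_prime P A" using primeideal.I_prime[OF P] I by (auto simp: is_prime_def)
next
  assume P: "is_prime P A"
  then show "primeideal P (ring_of A)"
    using is_subringD(2)[OF A]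
    by (intro primeidealI cring_ring_of[OF A]) (auto simp: ideal_ring_of[OF A] is_prime_def)
qed

lemma krull_dim_ring_of:
  assumes "is_subring A"
  shows "krull_dim (ring_of A) = Sup {ereal (real d) | d.
     \<exists>P :: nat \<Rightarrow> 'a::comm_ring_1 set. (\<forall>i\<le>d. is_prime (P i) A) \<and> (\<forall>i<d. P i \<subset> P (Suc i))}"
  by (simp add: krull_dim_def primeideal_ring_of[OF assms])

text \<open>
  A chain in the smaller algebra yields independent elements; these stay independent in the larger
  algebra, which is finitely generated, and yield there a chain of the same length.
\<close>

proposition krull_dim_mono:
  fixes K :: "'a::idom set"
  assumes K: "is_subfield K" "infinite K" and sub: "set xs \<subseteq> adjoin K ys"
  shows "krull_dim (ring_of (adjoin K xs)) \<le> krull_dim (ring_of (adjoin K ys))"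
proof -
  have Ks: "is_subring K" using K by (simp add: is_subfield_def)
  note R = is_subring_adjoin[OF Ks]
  have KR: "K \<subseteq> adjoin K zs" for zs by (rule adjoin_base[OF is_subringD(1)[OF Ks]])
  have le: "adjoin K xs \<subseteq> adjoin K ys"
    by (rule adjoin_least[OF R is_subringD(1)[OF Ks] KR sub])
  show ?thesis
    unfolding krull_dim_ring_of[OF R]
  proof (rule Sup_subset_mono, safe)
    fix d and P :: "nat \<Rightarrow> 'a set"
    assume "\<forall>i\<le>d. is_prime (P i) (adjoin K xs)" "\<forall>i<d. P i \<subset> P (Suc i)"
    from alg_indep_from_prime_chain[OF R K(1) KR this]
    obtain zs where zs: "length zs = d" "set zs \<subseteq> adjoin K xs" "alg_indep K zs"
      by auto
    have "set zs \<subseteq> adjoin K ys" using zs(2) le by (rule subset_trans)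
    from prime_chain_from_alg_indep[OF Ks K(2) this zs(3)] zs(1)
    show "\<exists>d'. ereal (real d) = ereal (real d') \<and> (\<exists>P :: nat \<Rightarrow> 'a set.
        (\<forall>i\<le>d'. is_prime (P i) (adjoin K ys)) \<and> (\<forall>i<d'. P i \<subset> P (Suc i)))"
      by (intro exI[of _ d]) simp
  qed
qed

lemma krull_dim_le_of_iso:
  assumes R: "cring R" and S: "cring S" and h: "h \<in> ring_iso R S"
  shows "krull_dim S \<le> krull_dim R"
  unfolding krull_dim_def
proof (rule Sup_subset_mono, safe)
  have hom: "h \<in> ring_hom R S" and bij: "bij_betw h (carrier R) (carrier S)"
    using h by (auto simp: ring_iso_def)
  interpret ring_hom_ring R S h
    using R S hom by (intro ring_hom_ringI2) (auto simp: cring_def)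
  fix d and P :: "nat \<Rightarrow> 'c set"
  assume P: "\<forall>i\<le>d. primeideal (P i) S" "\<forall>i<d. P i \<subset> P (Suc i)"
  define Q where "Q i = {r \<in> carrier R. h r \<in> P i}" for i
  have img: "h ` Q i = P i" if "i \<le> d" for i
  proof -
    have "P i \<subseteq> carrier S"
      using P(1) that by (auto simp: primeideal_def ideal_def dest: additive_subgroup.a_subset)
    then show ?thesis using bij by (auto simp: Q_def bij_betw_def)
  qed
  have "\<forall>i\<le>d. primeideal (Q i) R" using primeideal_vimage[OF R] P(1) by (simp add: Q_def)
  moreover have "\<forall>i<d. Q i \<subset> Q (Suc i)"
  proof (intro allI impI psubsetI)
    fix i assume i: "i < d"
    show "Q i \<subseteq> Q (Suc i)" using P(2) i by (auto simp: Q_def)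
    show "Q i \<noteq> Q (Suc i)" using P(2) i img[of i] img[of "Suc i"] by force
  qed
  ultimately show "\<exists>d'. ereal (real d) = ereal (real d') \<and> (\<exists>P :: nat \<Rightarrow> 'a set.
      (\<forall>i\<le>d'. primeideal (P i) R) \<and> (\<forall>i<d'. P i \<subset> P (Suc i)))" by blast
qed

lemma krull_dim_iso:
  assumes R: "cring R" and S: "cring S" and h: "h \<in> ring_iso R S"
  shows "krull_dim R = krull_dim S"
proof -
  have "R \<simeq> S" using h by (auto simp: is_ring_iso_def)
  then have "S \<simeq> R" using ring_iso_sym R by (auto simp: cring_def)
  then obtain g where "g \<in> ring_iso S R" by (auto simp: is_ring_iso_def)
  then show ?thesis
    using krull_dim_le_of_iso[OF R S h] krull_dim_le_of_iso[OF S R] by (simp add: antisym)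
qed

section \<open>Homogeneous components\<close>

definition total_degree :: "('v \<Rightarrow>\<^sub>0 nat) \<Rightarrow> nat" where
  "total_degree m = (\<Sum>v\<in>Poly_Mapping.keys m. Poly_Mapping.lookup m v)"

lemma total_degree_superset:
  assumes "finite S" "Poly_Mapping.keys m \<subseteq> S"
  shows "total_degree m = (\<Sum>v\<in>S. Poly_Mapping.lookup m v)"
  unfolding total_degree_def using assms
  by (intro sum.mono_neutral_left) (auto simp: in_keys_iff)

lemma total_degree_zero [simp]: "total_degree 0 = 0"
  by (simp add: total_degree_def)

lemma total_degree_single [simp]: "total_degree (Poly_Mapping.single v n) = n"
  by (cases "n = 0") (auto simp: total_degree_def)

lemma total_degree_add [simp]: "total_degree (m + m') = total_degree m + total_degree m'"
proof -
  let ?S = "Poly_Mapping.keys m \<union> Poly_Mapping.keys m'"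
  have "total_degree m'' = (\<Sum>v\<in>?S. Poly_Mapping.lookup m'' v)" if "m'' \<in> {m, m', m + m'}" for m''
    using that Poly_Mapping.keys_add[of m m'] by (intro total_degree_superset) auto
  then show ?thesis by (simp add: lookup_add sum.distrib)
qed

lemma total_degree_eq_0_iff: "total_degree m = 0 \<longleftrightarrow> m = 0"
  by (auto simp: total_degree_def in_keys_iff intro!: poly_mapping_eqI)

definition hom_comp :: "nat \<Rightarrow> ('v, 'k::comm_ring_1) mpoly \<Rightarrow> ('v, 'k) mpoly" where
  "hom_comp d p = Poly_Mapping.mapp (\<lambda>m c. c when total_degree m = d) p"

lemma lookup_hom_comp: "Poly_Mapping.lookup (hom_comp d p) m = (Poly_Mapping.lookup p m when total_degree m = d)"
  by (auto simp: hom_comp_def lookup_mapp when_def in_keys_iff)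

lemma hom_comp_0 [simp]: "hom_comp d 0 = 0"
  by (intro poly_mapping_eqI) (simp add: lookup_hom_comp)

lemma hom_comp_add: "hom_comp d (p + q) = hom_comp d p + hom_comp d q"
  by (intro poly_mapping_eqI) (simp add: lookup_hom_comp lookup_add when_def)

lemma hom_comp_diff: "hom_comp d (p - q) = hom_comp d p - hom_comp d q"
  by (intro poly_mapping_eqI) (simp add: lookup_hom_comp lookup_minus when_def)

lemma hom_comp_sum: "hom_comp d (sum f S) = (\<Sum>i\<in>S. hom_comp d (f i))"
  by (induction S rule: infinite_finite_induct) (auto simp: hom_comp_add)

lemma hom_comp_single:
  "hom_comp d (Poly_Mapping.single m c) = (Poly_Mapping.single m c when total_degree m = d)"
  by (intro poly_mapping_eqI) (auto simp: lookup_hom_comp lookup_single when_def)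

lemma hom_comp_hom_comp: "hom_comp i (hom_comp j p) = (hom_comp j p when i = j)"
  by (intro poly_mapping_eqI) (auto simp: lookup_hom_comp when_def)

lemma poly_mapping_sum_single: "p = (\<Sum>m\<in>Poly_Mapping.keys p. Poly_Mapping.single m (Poly_Mapping.lookup p m))"
proof (intro poly_mapping_eqI)
  fix m
  have "Poly_Mapping.lookup (\<Sum>m\<in>Poly_Mapping.keys p. Poly_Mapping.single m (Poly_Mapping.lookup p m)) m
      = (\<Sum>m'\<in>Poly_Mapping.keys p. Poly_Mapping.lookup p m' when m' = m)"
    by (simp add: lookup_sum lookup_single)
  also have "\<dots> = Poly_Mapping.lookup p m"
    by (simp add: when_def sum.delta in_keys_iff)
  finally show "Poly_Mapping.lookup p m = Poly_Mapping.lookup (\<Sum>m\<in>Poly_Mapping.keys p. Poly_Mapping.single m (Poly_Mapping.lookup p m)) m" ..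
qed

text \<open>
  Both sides are bilinear, so it suffices to compare them on monomials.
\<close>

lemma hom_comp_mult:
  "hom_comp n (p * q) = (\<Sum>i\<le>n. hom_comp i p * hom_comp (n - i) q)"
proof -
  have mono: "hom_comp n (Poly_Mapping.single a c * Poly_Mapping.single b d)
     = (\<Sum>i\<le>n. hom_comp i (Poly_Mapping.single a c) * hom_comp (n - i) (Poly_Mapping.single b d))" for a b and c d :: 'b
  proof -
    have "(\<Sum>i\<le>n. hom_comp i (Poly_Mapping.single a c) * hom_comp (n - i) (Poly_Mapping.single b d))
      = (\<Sum>i\<le>n. if i = total_degree a then Poly_Mapping.single (a + b) (c * d) when total_degree b = n - total_degree a else 0)"
      by (intro sum.cong) (auto simp: hom_comp_single when_def mult_single)
    then show ?thesis by (auto simp: hom_comp_single mult_single when_def)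
  qed
  define P where "P = Poly_Mapping.keys p"
  define Q where "Q = Poly_Mapping.keys q"
  have p: "p = (\<Sum>a\<in>P. Poly_Mapping.single a (Poly_Mapping.lookup p a))" and q: "q = (\<Sum>b\<in>Q. Poly_Mapping.single b (Poly_Mapping.lookup q b))"
    unfolding P_def Q_def by (rule poly_mapping_sum_single)+
  have "hom_comp n (p * q) = (\<Sum>a\<in>P. \<Sum>b\<in>Q. \<Sum>i\<le>n.
     hom_comp i (Poly_Mapping.single a (Poly_Mapping.lookup p a)) * hom_comp (n - i) (Poly_Mapping.single b (Poly_Mapping.lookup q b)))"
    by (subst p, subst q) (simp add: sum_product hom_comp_sum mono)
  also have "\<dots> = (\<Sum>i\<le>n. \<Sum>a\<in>P. \<Sum>b\<in>Q.
     hom_comp i (Poly_Mapping.single a (Poly_Mapping.lookup p a)) * hom_comp (n - i) (Poly_Mapping.single b (Poly_Mapping.lookup q b)))"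
    by (subst sum.swap, rule sum.cong[OF refl]) (rule sum.swap)
  also have "\<dots> = (\<Sum>i\<le>n. hom_comp i p * hom_comp (n - i) q)"
  proof (rule sum.cong[OF refl])
    fix i
    have "hom_comp i p = (\<Sum>a\<in>P. hom_comp i (Poly_Mapping.single a (Poly_Mapping.lookup p a)))"
      "hom_comp (n - i) q = (\<Sum>b\<in>Q. hom_comp (n - i) (Poly_Mapping.single b (Poly_Mapping.lookup q b)))"
      by (subst p q, simp only: hom_comp_sum)+
    then show "(\<Sum>a\<in>P. \<Sum>b\<in>Q. hom_comp i (Poly_Mapping.single a (Poly_Mapping.lookup p a))
        * hom_comp (n - i) (Poly_Mapping.single b (Poly_Mapping.lookup q b))) = hom_comp i p * hom_comp (n - i) q"
      by (simp only: sum_product)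
  qed
  finally show ?thesis .
qed

text \<open>
  The \<open>k\<close>-th step of the order filtration, i.e. the \<open>k\<close>-th power of the ideal generated by all variables.
\<close>

definition vanishing_below :: "nat \<Rightarrow> ('v, 'k::comm_ring_1) mpoly set" where
  "vanishing_below k = {p. \<forall>i<k. hom_comp i p = 0}"

lemma hom_comp_mult_lowest:
  assumes p: "p \<in> vanishing_below a" and q: "q \<in> vanishing_below b"
  shows "hom_comp (a + b) (p * q) = hom_comp a p * hom_comp b q"
proof -
  have "hom_comp (a + b) (p * q) = (\<Sum>i\<le>a+b. if i = a then hom_comp a p * hom_comp b q else 0)"
    unfolding hom_comp_mult
  proof (rule sum.cong)
    fix i assume "i \<in> {..a + b}"
    then show "hom_comp i p * hom_comp (a + b - i) q = (if i = a then hom_comp a p * hom_comp b q else 0)"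
      using p q by (cases i a rule: linorder_cases) (auto simp: vanishing_below_def)
  qed auto
  then show ?thesis by simp
qed

lemma vanishing_below_mult:
  assumes p: "p \<in> vanishing_below a" and q: "q \<in> vanishing_below b"
  shows "p * q \<in> vanishing_below (a + b)"
  unfolding vanishing_below_def
proof (intro CollectI allI impI)
  fix i assume i: "i < a + b"
  show "hom_comp i (p * q) = 0"
    unfolding hom_comp_mult
  proof (rule sum.neutral, rule ballI)
    fix j assume "j \<in> {..i}"
    then show "hom_comp j p * hom_comp (i - j) q = 0"
      using p q i by (cases "j < a") (auto simp: vanishing_below_def)
  qed
qed

lemma vanishing_below_add: "p \<in> vanishing_below a \<Longrightarrow> q \<in> vanishing_below a \<Longrightarrow> p + q \<in> vanishing_below a"
  by (simp add: vanishing_below_def hom_comp_add)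

lemma vanishing_below_0: "p \<in> vanishing_below 0"
  by (simp add: vanishing_below_def)

lemma zero_in_vanishing_below: "0 \<in> vanishing_below k"
  by (simp add: vanishing_below_def)

lemma homogeneous_mult:
  assumes "hom_comp a p = p" "hom_comp b q = q"
  shows "hom_comp (a + b) (p * q) = p * q"
proof -
  have "p \<in> vanishing_below a" "q \<in> vanishing_below b"
    unfolding vanishing_below_def
    using hom_comp_hom_comp[of _ a p] hom_comp_hom_comp[of _ b q] assms by auto
  then show ?thesis using hom_comp_mult_lowest assms by metis
qed

definition polys_in :: "'v set \<Rightarrow> ('v, 'k::field) mpoly set" where
  "polys_in V = {p. \<forall>m\<in>Poly_Mapping.keys p. Poly_Mapping.keys m \<subseteq> V}"

lemma mpoly_ring_eq: "mpoly_ring V = ring_of (polys_in V)"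
  by (simp add: mpoly_ring_def ring_of_def polys_in_def)

lemma is_subring_polys_in: "is_subring (polys_in V :: ('v, 'k::field) mpoly set)"
  unfolding is_subring_def
proof (intro conjI ballI)
  show "0 \<in> (polys_in V :: ('v, 'k) mpoly set)" "1 \<in> (polys_in V :: ('v, 'k) mpoly set)"
    by (auto simp: polys_in_def)
next
  fix p assume "p \<in> (polys_in V :: ('v, 'k) mpoly set)"
  then show "- p \<in> polys_in V" by (auto simp: polys_in_def in_keys_iff)
next
  fix p q assume *: "p \<in> (polys_in V :: ('v, 'k) mpoly set)" "q \<in> (polys_in V :: ('v, 'k) mpoly set)"
  then show "p + q \<in> polys_in V" using Poly_Mapping.keys_add[of p q] by (auto simp: polys_in_def)
  show "p * q \<in> polys_in V"
    unfolding polys_in_def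
  proof (intro CollectI ballI)
    fix m assume "m \<in> Poly_Mapping.keys (p * q)"
    then obtain a b where "m = a + b" "a \<in> Poly_Mapping.keys p" "b \<in> Poly_Mapping.keys q"
      using keys_mult[of p q] by auto
    then show "Poly_Mapping.keys m \<subseteq> V" using * Poly_Mapping.keys_add[of a b] unfolding polys_in_def by blast
  qed
qed

lemma hom_comp_polys_in: "p \<in> polys_in V \<Longrightarrow> hom_comp d p \<in> polys_in V"
  by (auto simp: polys_in_def hom_comp_def dest!: subsetD[OF keys_mapp_subset])

definition constants :: "('v, 'k::field) mpoly set" where
  "constants = range (Poly_Mapping.single 0)"

lemma constants_subset: "constants \<subseteq> polys_in V"
  by (auto simp: constants_def polys_in_def split: if_splits)

lemma is_subfield_constants: "is_subfield (constants :: ('v, 'k::field) mpoly set)"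
proof -
  have sub: "is_subring (constants :: ('v, 'k) mpoly set)"
    unfolding is_subring_def
  proof (intro conjI ballI)
    show "0 \<in> (constants :: ('v, 'k) mpoly set)" "1 \<in> (constants :: ('v, 'k) mpoly set)"
      unfolding constants_def using single_zero single_one by (metis rangeI)+
  qed (auto simp: constants_def mult_single simp flip: single_add single_uminus)
  have "\<exists>b\<in>constants. a * b = 1" if a: "a \<in> constants" "a \<noteq> 0" for a :: "('v, 'k) mpoly"
  proof -
    obtain c where c: "a = Poly_Mapping.single 0 c" using a by (auto simp: constants_def)
    moreover have "c \<noteq> 0" using a(2) c by (metis single_zero)
    ultimately show ?thesis
      by (intro bexI[of _ "Poly_Mapping.single 0 (inverse c)"]) (auto simp: mult_single constants_def)
  qed
  with sub show ?thesis by (simp add: is_subfield_def)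
qed

lemma infinite_constants:
  assumes "infinite (UNIV :: 'k::field set)"
  shows "infinite (constants :: ('v, 'k) mpoly set)"
  unfolding constants_def using assms by (simp add: finite_image_iff)

lemma hom_comp_0_constant: "hom_comp 0 p \<in> constants"
proof -
  have "hom_comp 0 p = Poly_Mapping.single 0 (Poly_Mapping.lookup p 0)"
    by (intro poly_mapping_eqI) (auto simp: lookup_hom_comp lookup_single total_degree_eq_0_iff when_def)
  then show ?thesis by (simp add: constants_def)
qed

lemma hom_comp_0_of_constant: "c \<in> constants \<Longrightarrow> hom_comp 0 c = c"
  by (auto simp: constants_def hom_comp_single)

lemma genideal_ring_of:
  assumes A: "is_subring A" and S: "S \<subseteq> A"
  shows "is_ideal (genideal (ring_of A) S) A" "S \<subseteq> genideal (ring_of A) S"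
    "is_ideal I A \<Longrightarrow> S \<subseteq> I \<Longrightarrow> genideal (ring_of A) S \<subseteq> I"
proof -
  interpret cring "ring_of A" by (rule cring_ring_of[OF A])
  show "is_ideal (genideal (ring_of A) S) A" using genideal_ideal[of S] S ideal_ring_of[OF A] by simp
  show "S \<subseteq> genideal (ring_of A) S" using genideal_self[of S] S by simp
  show "is_ideal I A \<Longrightarrow> S \<subseteq> I \<Longrightarrow> genideal (ring_of A) S \<subseteq> I"
    using genideal_minimal[of I S] ideal_ring_of[OF A] by simp
qed

lemma mvar_in_polys_in: "v \<in> V \<Longrightarrow> mvar v \<in> polys_in V"
  by (auto simp: mvar_def polys_in_def)

lemma is_ideal_vanishing_below:
  fixes A :: "('v, 'k::comm_ring_1) mpoly set"
  assumes A: "is_subring A"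
  shows "is_ideal (A \<inter> vanishing_below k) A"
  unfolding is_ideal_def
  using is_subringD[OF A] vanishing_below_add[of _ k] zero_in_vanishing_below[of k]
    vanishing_below_mult[OF vanishing_below_0, of _ k]
  by auto

text \<open>
  A polynomial without constant term is a sum of monomials, each divisible by a variable.
\<close>

lemma irrelevant_ideal_eq:
  "irrelevant_ideal V = (polys_in V \<inter> vanishing_below 1 :: ('v, 'k::field) mpoly set)"
proof
  let ?A = "polys_in V :: ('v, 'k) mpoly set" and ?m = "irrelevant_ideal V :: ('v, 'k) mpoly set"
  have S: "(mvar ` V :: ('v, 'k) mpoly set) \<subseteq> polys_in V" by (auto simp: mvar_in_polys_in)
  have m: "is_ideal ?m ?A" "mvar ` V \<subseteq> ?m" "is_ideal I ?A \<Longrightarrow> mvar ` V \<subseteq> I \<Longrightarrow> ?m \<subseteq> I" for I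
    using genideal_ring_of[OF is_subring_polys_in S]
    by (simp_all add: irrelevant_ideal_def mpoly_ring_eq)
  show "?m \<subseteq> ?A \<inter> vanishing_below 1"
    using S by (intro m(3) is_ideal_vanishing_below is_subring_polys_in)
      (auto simp: vanishing_below_def mvar_def hom_comp_single)
  show "?A \<inter> vanishing_below 1 \<subseteq> ?m"
  proof
    fix p :: "('v, 'k) mpoly" assume p: "p \<in> ?A \<inter> vanishing_below 1"
    have "Poly_Mapping.single a (Poly_Mapping.lookup p a) \<in> ?m" if a: "a \<in> Poly_Mapping.keys p" for a
    proof -
      have "a \<noteq> 0"
      proof
        assume "a = 0"
        then have "Poly_Mapping.lookup (hom_comp 0 p) 0 \<noteq> 0" using a by (simp add: lookup_hom_comp in_keys_iff)
        then show False using p by (simp add: vanishing_below_def)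
      qed
      then obtain v where v: "v \<in> Poly_Mapping.keys a"
        by (metis in_keys_iff lookup_zero poly_mapping_eqI)
      define b where "b = a - Poly_Mapping.single v 1"
      have ab: "a = b + Poly_Mapping.single v 1"
        using v by (intro poly_mapping_eqI)
          (auto simp: b_def lookup_add lookup_minus lookup_single when_def in_keys_iff)
      have aV: "Poly_Mapping.keys a \<subseteq> V" using p a by (auto simp: polys_in_def)
      have "Poly_Mapping.keys b \<subseteq> Poly_Mapping.keys a"
        by (auto simp: b_def in_keys_iff lookup_minus)
      then have "Poly_Mapping.single b (Poly_Mapping.lookup p a) \<in> ?A"
        using aV by (auto simp: polys_in_def)
      moreover have "mvar v \<in> ?m" using v aV m(2) by blast
      ultimately have "Poly_Mapping.single b (Poly_Mapping.lookup p a) * mvar v \<in> ?m" by (rule is_idealD(4)[OF m(1)])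
      then show ?thesis unfolding mvar_def mult_single mult_1_right ab[symmetric] .
    qed
    then have "(\<Sum>a\<in>Poly_Mapping.keys p. Poly_Mapping.single a (Poly_Mapping.lookup p a)) \<in> ?m"
      by (rule is_ideal_sum[OF m(1)])
    then show "p \<in> ?m" by (simp only: poly_mapping_sum_single[symmetric])
  qed
qed

section \<open>The special fiber of an ideal generated in one degree\<close>

text \<open>
  Let \<open>J\<close> be generated by forms \<open>xs\<close> of the same degree \<open>\<delta> > 0\<close>. Then \<open>J^k\<close> lives in degrees at least \<open>\<delta> k\<close>, its
  part of degree \<open>\<delta> k\<close> consists of the forms of degree \<open>k\<close> in the generators, and the part of higher
  degree is \<open>\<mm> J^k\<close>. Hence taking lowest degree components maps the Rees algebra onto \<open>K[xs]\<close> with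
  kernel generated by \<open>\<mm>\<close>, and the special fiber ring is \<open>K[xs]\<close>.
\<close>

locale equigenerated =
  fixes V :: "'v set" and \<delta> :: nat and xs :: "('v, 'k::field) mpoly list"
  assumes degree_pos: "\<delta> > 0"
    and gens_in: "set xs \<subseteq> polys_in V"
    and gens_hom: "x \<in> set xs \<Longrightarrow> hom_comp \<delta> x = x"
begin

abbreviation "R \<equiv> mpoly_ring V :: ('v, 'k) mpoly ring"
abbreviation "A \<equiv> polys_in V :: ('v, 'k) mpoly set"
abbreviation "\<mm> \<equiv> irrelevant_ideal V :: ('v, 'k) mpoly set"
abbreviation "J \<equiv> genideal R (set xs)"
abbreviation "fiber \<equiv> adjoin constants xs"
abbreviation "Rees \<equiv> rees_algebra R J"

definition Jpow :: "nat \<Rightarrow> ('v, 'k) mpoly set" where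
  "Jpow k = J [^]\<^bsub>ideals_set R\<^esub> k"

lemma subring_A: "is_subring A" by (rule is_subring_polys_in)

lemma Jpow_0: "Jpow 0 = A"
  by (simp add: Jpow_def ideals_set_def mpoly_ring_eq)

lemma Jpow_Suc: "Jpow (Suc k) = ideal_prod R (Jpow k) J"
  by (simp add: Jpow_def ideals_set_def)

lemma ideal_J: "is_ideal J A" and gens_J: "set xs \<subseteq> J"
  and J_least: "is_ideal I A \<Longrightarrow> set xs \<subseteq> I \<Longrightarrow> J \<subseteq> I"
  using genideal_ring_of[OF subring_A gens_in] by (simp_all add: mpoly_ring_eq)

lemma ideal_prod_ideal:
  assumes "is_ideal I A" "is_ideal I' A"
  shows "is_ideal (ideal_prod R I I') A"
proof -
  interpret cring "ring_of A" by (rule cring_ring_of[OF subring_A])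
  show ?thesis
    using ideal_prod_is_ideal[of I I'] assms by (simp add: ideal_ring_of[OF subring_A] mpoly_ring_eq)
qed

lemma ideal_prod_mult: "a \<in> I \<Longrightarrow> b \<in> I' \<Longrightarrow> a * b \<in> ideal_prod R I I'"
  using ideal_prod.prod[of a I b I' R] by (simp add: mpoly_ring_eq)

lemma ideal_prod_induct [consumes 1, case_names mult add]:
  assumes "x \<in> ideal_prod R I I'"
    and "\<And>a b. a \<in> I \<Longrightarrow> b \<in> I' \<Longrightarrow> P (a * b)"
    and "\<And>x y. x \<in> ideal_prod R I I' \<Longrightarrow> P x \<Longrightarrow>
      y \<in> ideal_prod R I I' \<Longrightarrow> P y \<Longrightarrow> P (x + y)"
  shows "P x"
  using assms(1) by (induction rule: ideal_prod.induct) (use assms in \<open>auto simp: mpoly_ring_eq\<close>)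

lemma ideal_Jpow: "is_ideal (Jpow k) A"
proof (induction k)
  case 0
  then show ?case by (simp add: Jpow_0 is_ideal_self[OF subring_A])
next
  case (Suc k)
  then show ?case unfolding Jpow_Suc by (rule ideal_prod_ideal[OF _ ideal_J])
qed

lemma ideal_m: "is_ideal \<mm> A"
  unfolding irrelevant_ideal_eq by (rule is_ideal_vanishing_below[OF subring_A])

abbreviation "mJpow k \<equiv> ideal_prod R \<mm> (Jpow k)"

lemma ideal_mJpow: "is_ideal (mJpow k) A"
  by (rule ideal_prod_ideal[OF ideal_m ideal_Jpow])

lemma Jpow_mult: "a \<in> Jpow i \<Longrightarrow> b \<in> Jpow j \<Longrightarrow> a * b \<in> Jpow (i + j)"
proof (induction j arbitrary: b)
  case 0
  then show ?case
    using is_idealD(5)[OF ideal_Jpow, of b a i] by (simp add: Jpow_0)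
next
  case (Suc j)
  from Suc.prems(2) show ?case
    unfolding Jpow_Suc
  proof (induction rule: ideal_prod_induct)
    case (mult b c)
    then have "a * b * c \<in> Jpow (Suc (i + j))"
      unfolding Jpow_Suc by (intro ideal_prod_mult Suc.IH Suc.prems)
    then show ?case by (simp add: mult.assoc)
  next
    case (add b c)
    then show ?case using is_idealD(3)[OF ideal_Jpow] by (simp add: distrib_left)
  qed
qed

lemma mJpow_mult:
  assumes "a \<in> mJpow i" "b \<in> Jpow j"
  shows "a * b \<in> mJpow (i + j)"
  using assms(1)
proof (induction rule: ideal_prod_induct)
  case (mult x y)
  then show ?case using ideal_prod_mult[OF mult(1) Jpow_mult[OF mult(2) assms(2)]] by (simp add: mult.assoc)
next
  case (add x y)
  then show ?case using is_idealD(3)[OF ideal_mJpow] by (simp add: distrib_right)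
qed

lemma J_order: "J \<subseteq> vanishing_below \<delta>"
proof -
  have "set xs \<subseteq> vanishing_below \<delta>"
  proof
    fix x assume x: "x \<in> set xs"
    have "hom_comp i x = 0" if "i < \<delta>" for i
      using hom_comp_hom_comp[of i \<delta> x] gens_hom[OF x] that by simp
    then show "x \<in> vanishing_below \<delta>" by (simp add: vanishing_below_def)
  qed
  then have "J \<subseteq> A \<inter> vanishing_below \<delta>"
    using gens_in by (intro J_least is_ideal_vanishing_below subring_A) auto
  then show ?thesis by blast
qed

lemma Jpow_order: "Jpow k \<subseteq> vanishing_below (\<delta> * k)"
proof (induction k)
  case 0
  then show ?case by (auto simp: vanishing_below_0)
next
  case (Suc k)
  show ?case
  proof
    fix p assume "p \<in> Jpow (Suc k)"
    then show "p \<in> vanishing_below (\<delta> * Suc k)"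
      unfolding Jpow_Suc
    proof (induction rule: ideal_prod_induct)
      case (mult a b)
      then have "a * b \<in> vanishing_below (\<delta> * k + \<delta>)"
        using Suc.IH J_order by (intro vanishing_below_mult) auto
      then show ?case by (simp add: algebra_simps)
    qed (rule vanishing_below_add)
  qed
qed

lemma mJpow_order: "mJpow k \<subseteq> vanishing_below (Suc (\<delta> * k))"
proof
  fix p assume "p \<in> mJpow k"
  then show "p \<in> vanishing_below (Suc (\<delta> * k))"
  proof (induction rule: ideal_prod_induct)
    case (mult a b)
    then have "a * b \<in> vanishing_below (1 + \<delta> * k)"
      using Jpow_order by (intro vanishing_below_mult) (auto simp: irrelevant_ideal_eq)
    then show ?case by simp
  qed (rule vanishing_below_add)
qed

lemma constants_subring: "is_subring (constants :: ('v, 'k) mpoly set)"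
  by (rule is_subfield_constants[unfolded is_subfield_def, THEN conjunct1])

lemma fiber_subring: "is_subring fiber"
  by (rule is_subring_adjoin[OF constants_subring])

lemma constants_fiber: "constants \<subseteq> fiber"
  by (rule adjoin_base[OF is_subringD(1)[OF constants_subring]])

lemma gens_fiber: "set xs \<subseteq> fiber"
  by (rule adjoin_elements[OF constants_subring])

lemma constant_part:
  assumes "a \<in> A"
  shows "hom_comp 0 a \<in> fiber" "hom_comp 0 a \<in> A" "a - hom_comp 0 a \<in> \<mm>"
proof -
  show "hom_comp 0 a \<in> fiber" using constants_fiber hom_comp_0_constant by blast
  show "hom_comp 0 a \<in> A" using assms by (rule hom_comp_polys_in)
  with assms have "a - hom_comp 0 a \<in> A" by (intro is_subringD[OF subring_A])
  then show "a - hom_comp 0 a \<in> \<mm>"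
    by (simp add: irrelevant_ideal_eq vanishing_below_def hom_comp_diff hom_comp_hom_comp)
qed

text \<open>
  The candidates for the lowest degree component of an element of \<open>J^k\<close>.
\<close>

definition lead :: "nat \<Rightarrow> ('v, 'k) mpoly set" where
  "lead k = {g \<in> fiber \<inter> Jpow k. hom_comp (\<delta> * k) g = g}"

lemma lead_add: "g \<in> lead k \<Longrightarrow> g' \<in> lead k \<Longrightarrow> g + g' \<in> lead k"
  using is_idealD(3)[OF ideal_Jpow] is_subringD(4)[OF fiber_subring]
  by (auto simp: lead_def hom_comp_add)

lemma lead_mult: "g \<in> lead i \<Longrightarrow> g' \<in> lead j \<Longrightarrow> g * g' \<in> lead (i + j)"
  using Jpow_mult[of g i g' j] is_subringD(5)[OF fiber_subring, of g g'] homogeneous_mult[of "\<delta> * i" g "\<delta> * j" g']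
  by (auto simp: lead_def algebra_simps)

lemma zero_lead: "0 \<in> lead k"
  using is_idealD(2)[OF ideal_Jpow] is_subringD(1)[OF fiber_subring] by (auto simp: lead_def)

lemma J_eq_Jpow_1: "J \<subseteq> Jpow 1"
proof
  fix f assume "f \<in> J"
  then have "1 * f \<in> Jpow (Suc 0)"
    unfolding Jpow_Suc Jpow_0 by (intro ideal_prod_mult is_subringD(2)[OF subring_A])
  then show "f \<in> Jpow 1" by simp
qed

text \<open>
  The elements for which the claim holds form an ideal that contains the generators; a multiplier is
  split into its constant term and a part in \<open>\<mm>\<close>.
\<close>

lemma leading_form_J:
  assumes "f \<in> J"
  shows "\<exists>g\<in>lead 1. f - g \<in> mJpow 1"
proof -
  let ?I = "{f \<in> A. \<exists>g\<in>lead 1. f - g \<in> mJpow 1}"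
  have "J \<subseteq> ?I"
  proof (rule J_least)
    show "is_ideal ?I A"
      unfolding is_ideal_def
    proof (intro conjI ballI)
      show "?I \<subseteq> A" by blast
      show "0 \<in> ?I" using zero_lead[of 1] is_idealD(2)[OF ideal_mJpow] is_subringD(1)[OF subring_A] by force
    next
      fix a b assume "a \<in> ?I" "b \<in> ?I"
      then obtain g h where *: "a \<in> A" "b \<in> A" "g \<in> lead 1" "h \<in> lead 1" "a - g \<in> mJpow 1" "b - h \<in> mJpow 1"
        by blast
      have "(a + b) - (g + h) \<in> mJpow 1"
        using is_idealD(3)[OF ideal_mJpow *(5,6)] by (simp add: algebra_simps)
      then show "a + b \<in> ?I" using lead_add[OF *(3,4)] is_subringD(4)[OF subring_A *(1,2)] by blast
    next
      fix a b assume a: "a \<in> A" and "b \<in> ?I"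
      then obtain g where *: "b \<in> A" "g \<in> lead 1" "b - g \<in> mJpow 1" by blast
      let ?c = "hom_comp 0 a"
      have "?c \<in> lead 0" using constant_part[OF a] by (simp add: lead_def hom_comp_hom_comp Jpow_0)
      then have "?c * g \<in> lead 1" using lead_mult[of ?c 0 g 1] *(2) by simp
      moreover have "a * (b - g) \<in> mJpow 1" using is_idealD(4)[OF ideal_mJpow a *(3)] .
      moreover have "(a - ?c) * g \<in> mJpow 1"
        using constant_part(3)[OF a] *(2) by (intro ideal_prod_mult) (auto simp: lead_def)
      ultimately have "?c * g \<in> lead 1" "a * b - ?c * g \<in> mJpow 1"
        using is_idealD(3)[OF ideal_mJpow, of "a * (b - g)" 1 "(a - ?c) * g"] by (auto simp: algebra_simps)
      then show "a * b \<in> ?I" using is_subringD(5)[OF subring_A a *(1)] by blast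
    qed
    show "set xs \<subseteq> ?I"
    proof
      fix x assume x: "x \<in> set xs"
      then have "x \<in> lead 1" using gens_fiber gens_J J_eq_Jpow_1 gens_hom by (auto simp: lead_def)
      then show "x \<in> ?I" using x gens_in is_idealD(2)[OF ideal_mJpow, of 1] by force
    qed
  qed
  then show ?thesis using assms by blast
qed

text \<open>
  For products, \<open>p q - g h = (p - g) q + (q - h) g\<close>.
\<close>

lemma leading_form:
  assumes "f \<in> Jpow k"
  shows "\<exists>g\<in>lead k. f - g \<in> mJpow k"
  using assms
proof (induction k arbitrary: f)
  case 0
  then have f: "f \<in> A" by (simp add: Jpow_0)
  have "hom_comp 0 f \<in> lead 0" using constant_part[OF f] by (simp add: lead_def hom_comp_hom_comp Jpow_0)
  moreover have "(f - hom_comp 0 f) * 1 \<in> mJpow 0"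
    using constant_part(3)[OF f] is_subringD(2)[OF subring_A] by (intro ideal_prod_mult) (simp_all add: Jpow_0)
  ultimately show ?case by (auto)
next
  case (Suc k)
  from Suc.prems show ?case
    unfolding Jpow_Suc[of k]
  proof (induction rule: ideal_prod_induct)
    case (mult p q)
    obtain g where g: "g \<in> lead k" "p - g \<in> mJpow k" using Suc.IH[OF mult(1)] by blast
    obtain h where h: "h \<in> lead 1" "q - h \<in> mJpow 1" using leading_form_J[OF mult(2)] by blast
    have "(p - g) * q \<in> mJpow (k + 1)" using J_eq_Jpow_1 mult(2) by (intro mJpow_mult[OF g(2)]) blast
    moreover have "(q - h) * g \<in> mJpow (1 + k)" using g(1) by (intro mJpow_mult[OF h(2)]) (simp add: lead_def)
    ultimately have "(p - g) * q + (q - h) * g \<in> mJpow (Suc k)"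
      using is_idealD(3)[OF ideal_mJpow, of "(p - g) * q" "Suc k" "(q - h) * g"] by (simp)
    moreover have "(p - g) * q + (q - h) * g = p * q - g * h" by (simp add: algebra_simps)
    moreover have "g * h \<in> lead (Suc k)" using lead_mult[OF g(1) h(1)] by simp
    ultimately show ?case unfolding Jpow_Suc[of k, symmetric] by auto
  next
    case (add a b)
    then obtain g h where *: "g \<in> lead (Suc k)" "h \<in> lead (Suc k)" "a - g \<in> mJpow (Suc k)" "b - h \<in> mJpow (Suc k)"
      unfolding Jpow_Suc[of k, symmetric] by blast
    have "(a + b) - (g + h) \<in> mJpow (Suc k)"
      using is_idealD(3)[OF ideal_mJpow *(3,4)] by (simp add: algebra_simps)
    then show ?case using lead_add[OF *(1,2)] unfolding Jpow_Suc[of k, symmetric] by blast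
  qed
qed

lemma hom_comp_mJpow: "f \<in> mJpow k \<Longrightarrow> hom_comp (\<delta> * k) f = 0"
  using mJpow_order by (auto simp: vanishing_below_def)

lemma hom_comp_Jpow_fiber:
  assumes "f \<in> Jpow k"
  shows "hom_comp (\<delta> * k) f \<in> fiber"
proof -
  obtain g where g: "g \<in> lead k" "f - g \<in> mJpow k" using leading_form[OF assms] by blast
  then have "hom_comp (\<delta> * k) f = g"
    using hom_comp_mJpow[OF g(2)] by (simp add: hom_comp_diff lead_def)
  then show ?thesis using g by (simp add: lead_def)
qed

text \<open>
  This is the injectivity of the comparison map: \<open>J^k/\<mm>J^k\<close> is detected in degree \<open>\<delta> k\<close>.
\<close>

lemma hom_comp_Jpow_eq_0:
  assumes "f \<in> Jpow k" "hom_comp (\<delta> * k) f = 0"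
  shows "f \<in> mJpow k"
proof -
  obtain g where g: "g \<in> lead k" "f - g \<in> mJpow k" using leading_form[OF assms(1)] by blast
  then have "g = 0"
    using hom_comp_mJpow[OF g(2)] assms(2) by (simp add: hom_comp_diff lead_def)
  then show ?thesis using g by simp
qed

subsection \<open>The Rees algebra\<close>

lemma up_iff: "f \<in> up R \<longleftrightarrow> (\<forall>k. f k \<in> A) \<and> (\<exists>n. \<forall>k>n. f k = 0)"
  by (auto simp: up_def mpoly_ring_eq bound_def Pi_def)

lemma UP_cring: "UP_cring R"
  by (simp add: UP_cring_def mpoly_ring_eq cring_ring_of[OF subring_A])

lemma Rees_carrier: "f \<in> carrier Rees \<longleftrightarrow> (\<forall>k. f k \<in> Jpow k) \<and> (\<exists>n. \<forall>k>n. f k = 0)"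
proof -
  have "f \<in> carrier Rees \<longleftrightarrow> f \<in> up R \<and> (\<forall>k. f k \<in> Jpow k)"
    by (auto simp: rees_algebra_def UP_def Jpow_def)
  then show ?thesis using is_idealD(1)[OF ideal_Jpow] unfolding up_iff by blast
qed

lemma Rees_up: "f \<in> carrier Rees \<Longrightarrow> f \<in> up R"
  using is_idealD(1)[OF ideal_Jpow] unfolding up_iff Rees_carrier by blast

lemma Rees_one: "\<one>\<^bsub>Rees\<^esub> = (\<lambda>k. if k = 0 then 1 else 0)"
  and Rees_zero: "\<zero>\<^bsub>Rees\<^esub> = (\<lambda>k. 0)"
  by (auto simp: rees_algebra_def UP_def mpoly_ring_eq)

lemma Rees_add: "f \<in> carrier Rees \<Longrightarrow> g \<in> carrier Rees \<Longrightarrow> f \<oplus>\<^bsub>Rees\<^esub> g = (\<lambda>k. f k + g k)"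
  using Rees_up[of f] Rees_up[of g] by (simp add: rees_algebra_def UP_def mpoly_ring_eq)

lemma Rees_mult:
  assumes "f \<in> carrier Rees" "g \<in> carrier Rees"
  shows "f \<otimes>\<^bsub>Rees\<^esub> g = (\<lambda>k. \<Sum>i\<le>k. f i * g (k - i))"
proof -
  have "f i \<in> A" "g i \<in> A" for i using assms Rees_up up_iff by blast+
  then have "f i * g j \<in> A" for i j by (intro is_subringD[OF subring_A])
  then have "finsum (ring_of A) (\<lambda>i. f i * g (k - i)) {..k} = (\<Sum>i\<le>k. f i * g (k - i))" for k
    by (intro finsum_ring_of[OF subring_A]) auto
  then show ?thesis
    using Rees_up[OF assms(1)] Rees_up[OF assms(2)] by (simp add: rees_algebra_def UP_def mpoly_ring_eq)
qed

lemma cring_Rees: "cring Rees"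
proof -
  interpret UP_cring R "UP R" by (rule UP_cring)
  let ?H = "carrier Rees"
  have sub: "?H \<subseteq> carrier (UP R)" by (auto simp: rees_algebra_def)
  have Rees_eq: "Rees = UP R \<lparr>carrier := ?H\<rparr>" by (simp add: rees_algebra_def)
  have ops: "\<one>\<^bsub>UP R\<^esub> = \<one>\<^bsub>Rees\<^esub>" "(\<otimes>\<^bsub>UP R\<^esub>) = (\<otimes>\<^bsub>Rees\<^esub>)"
    "(\<oplus>\<^bsub>UP R\<^esub>) = (\<oplus>\<^bsub>Rees\<^esub>)" "\<zero>\<^bsub>UP R\<^esub> = \<zero>\<^bsub>Rees\<^esub>"
    by (simp_all add: rees_algebra_def)
  have "subring ?H (UP R)"
  proof (rule P.subringI)
    show "\<one>\<^bsub>UP R\<^esub> \<in> ?H"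
      using is_idealD(2)[OF ideal_Jpow] is_subringD(2)[OF subring_A]
      unfolding ops Rees_one Rees_carrier by (auto simp: Jpow_0)
  next
    fix f assume f: "f \<in> ?H"
    have "- f k \<in> Jpow k" for k
      using is_ideal_diff[OF subring_A ideal_Jpow is_idealD(2)[OF ideal_Jpow], of "f k" k] f by (simp add: Rees_carrier)
    then have f': "(\<lambda>k. - f k) \<in> ?H" using f by (auto simp: Rees_carrier)
    have "(\<lambda>k. - f k) \<oplus>\<^bsub>UP R\<^esub> f = \<zero>\<^bsub>UP R\<^esub>"
      unfolding ops using Rees_add[OF f' f] by (simp add: Rees_zero)
    then have "\<ominus>\<^bsub>UP R\<^esub> f = (\<lambda>k. - f k)"
      by (rule P.minus_equality) (use f f' sub in blast)+
    with f' show "\<ominus>\<^bsub>UP R\<^esub> f \<in> ?H" by simp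
  next
    fix f g assume f: "f \<in> ?H" and g: "g \<in> ?H"
    obtain n m where nm: "\<And>k. k > n \<Longrightarrow> f k = 0" "\<And>k. k > m \<Longrightarrow> g k = 0" using f g by (auto simp: Rees_carrier)
    show "f \<oplus>\<^bsub>UP R\<^esub> g \<in> ?H"
      unfolding ops Rees_add[OF f g] Rees_carrier
    proof (intro conjI allI exI[of _ "max n m"] impI)
      show "f k + g k \<in> Jpow k" for k using f g is_idealD(3)[OF ideal_Jpow] by (simp add: Rees_carrier)
    qed (use nm in auto)
    show "f \<otimes>\<^bsub>UP R\<^esub> g \<in> ?H"
      unfolding ops Rees_mult[OF f g] Rees_carrier
    proof (intro conjI allI exI[of _ "n + m"] impI)
      fix k
      have "f i * g (k - i) \<in> Jpow k" if "i \<in> {..k}" for i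
        using Jpow_mult[of "f i" i "g (k - i)" "k - i"] f g that by (simp add: Rees_carrier)
      then show "(\<Sum>i\<le>k. f i * g (k - i)) \<in> Jpow k" by (rule is_ideal_sum[OF ideal_Jpow])
    next
      fix k assume "n + m < k"
      then have "f i * g (k - i) = 0" for i using nm(1)[of i] nm(2)[of "k - i"] by (cases "i > n") auto
      then show "(\<Sum>i\<le>k. f i * g (k - i)) = 0" by simp
    qed
  qed (rule sub)
  then show ?thesis
    using P.subcringI'[THEN P.subcring_iff[OF sub, THEN iffD1]] Rees_eq by simp
qed

text \<open>
  The image in \<open>K[xs][t]\<close> of an element of the Rees algebra under passage to lowest degree components.
  Setting \<open>t = 1\<close> below loses nothing, because the coefficient of \<open>t^k\<close> is homogeneous of degree \<open>\<delta> k\<close> and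
  \<open>\<delta>\<close> is positive.
\<close>

definition lead_poly :: "(nat \<Rightarrow> ('v, 'k) mpoly) \<Rightarrow> ('v, 'k) mpoly poly" where
  "lead_poly f = Abs_poly (\<lambda>k. hom_comp (\<delta> * k) (f k))"

lemma coeff_lead_poly:
  assumes "f \<in> carrier Rees"
  shows "poly.coeff (lead_poly f) k = hom_comp (\<delta> * k) (f k)"
proof -
  obtain n where "\<And>k. k > n \<Longrightarrow> f k = 0" using assms by (auto simp: Rees_carrier)
  then show ?thesis
    unfolding lead_poly_def by (subst coeff_Abs_poly[of n]) auto
qed

definition to_fiber :: "(nat \<Rightarrow> ('v, 'k) mpoly) \<Rightarrow> ('v, 'k) mpoly" where
  "to_fiber f = poly (lead_poly f) 1"

lemma to_fiber_closed:
  assumes f: "f \<in> carrier Rees"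
  shows "to_fiber f \<in> fiber"
proof -
  have "hom_comp (\<delta> * k) (f k) \<in> fiber" for k
    using f by (intro hom_comp_Jpow_fiber) (simp add: Rees_carrier)
  then have "lead_poly f \<in> polys_over fiber" by (simp add: polys_over_def coeff_lead_poly[OF f])
  then show ?thesis
    unfolding to_fiber_def using is_subringD(1,2)[OF fiber_subring]
    by (induction rule: polys_over_induct) (auto intro!: is_subringD[OF fiber_subring])
qed

lemma lead_poly_mult:
  assumes f: "f \<in> carrier Rees" and g: "g \<in> carrier Rees"
  shows "lead_poly (f \<otimes>\<^bsub>Rees\<^esub> g) = lead_poly f * lead_poly g"
proof (rule poly_eqI)
  fix k
  interpret Rees: cring Rees by (rule cring_Rees)
  have fg: "f \<otimes>\<^bsub>Rees\<^esub> g \<in> carrier Rees" using f g by simp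
  have "hom_comp (\<delta> * k) (f i * g (k - i)) = hom_comp (\<delta> * i) (f i) * hom_comp (\<delta> * (k - i)) (g (k - i))"
    if "i \<le> k" for i
  proof -
    have "f i \<in> vanishing_below (\<delta> * i)" "g (k - i) \<in> vanishing_below (\<delta> * (k - i))"
      using f g Jpow_order unfolding Rees_carrier by blast+
    from hom_comp_mult_lowest[OF this] that show ?thesis by (simp flip: distrib_left)
  qed
  then show "poly.coeff (lead_poly (f \<otimes>\<^bsub>Rees\<^esub> g)) k = poly.coeff (lead_poly f * lead_poly g) k"
    unfolding coeff_mult coeff_lead_poly[OF fg] coeff_lead_poly[OF f] coeff_lead_poly[OF g]
    by (simp add: Rees_mult[OF f g] hom_comp_sum)
qed

lemma lead_poly_add:
  assumes f: "f \<in> carrier Rees" and g: "g \<in> carrier Rees"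
  shows "lead_poly (f \<oplus>\<^bsub>Rees\<^esub> g) = lead_poly f + lead_poly g"
proof (rule poly_eqI)
  interpret Rees: cring Rees by (rule cring_Rees)
  have fg: "f \<oplus>\<^bsub>Rees\<^esub> g \<in> carrier Rees" using f g by simp
  show "poly.coeff (lead_poly (f \<oplus>\<^bsub>Rees\<^esub> g)) k = poly.coeff (lead_poly f + lead_poly g) k" for k
    unfolding coeff_add coeff_lead_poly[OF fg] coeff_lead_poly[OF f] coeff_lead_poly[OF g]
    by (simp add: Rees_add[OF f g] hom_comp_add)
qed

lemma const_Rees:
  assumes "a \<in> A"
  shows "(\<lambda>k. if k = 0 then a else 0) \<in> carrier Rees" (is "?f \<in> _")
    and "to_fiber (\<lambda>k. if k = 0 then a else 0) = hom_comp 0 a"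
proof -
  show f: "?f \<in> carrier Rees"
    using assms is_idealD(2)[OF ideal_Jpow] by (auto simp: Rees_carrier Jpow_0)
  have "lead_poly ?f = [:hom_comp 0 a:]"
    by (rule poly_eqI) (auto simp: coeff_lead_poly[OF f] coeff_pCons split: nat.splits)
  then show "to_fiber ?f = hom_comp 0 a" by (simp add: to_fiber_def)
qed

lemma gen_Rees:
  assumes "x \<in> set xs"
  shows "(\<lambda>k. if k = 1 then x else 0) \<in> carrier Rees" (is "?f \<in> _")
    and "to_fiber (\<lambda>k. if k = 1 then x else 0) = x"
proof -
  have "x \<in> Jpow 1" using assms gens_J J_eq_Jpow_1 by blast
  then show f: "?f \<in> carrier Rees"
    using is_idealD(2)[OF ideal_Jpow] by (auto simp: Rees_carrier)
  have "lead_poly ?f = [:0, x:]"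
    using gens_hom[OF assms]
    by (intro poly_eqI) (auto simp: coeff_lead_poly[OF f, unfolded One_nat_def] coeff_pCons split: nat.splits)
  then show "to_fiber ?f = x" by (simp add: to_fiber_def)
qed

lemma to_fiber_hom: "ring_hom_ring Rees (ring_of fiber) to_fiber"
proof (rule ring_hom_ringI2)
  interpret Rees: cring Rees by (rule cring_Rees)
  show "ring Rees" by (rule Rees.ring_axioms)
  show "ring (ring_of fiber)" using cring_ring_of[OF fiber_subring] by (simp add: cring_def)
  show "to_fiber \<in> ring_hom Rees (ring_of fiber)"
  proof (rule ring_hom_memI)
    show "to_fiber \<one>\<^bsub>Rees\<^esub> = \<one>\<^bsub>ring_of fiber\<^esub>"
      using const_Rees(2)[OF is_subringD(2)[OF subring_A]]
        hom_comp_0_of_constant[OF is_subringD(2)[OF constants_subring]] by (simp add: Rees_one)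
  qed (use to_fiber_closed in \<open>simp_all add: lead_poly_mult lead_poly_add to_fiber_def\<close>)
qed

lemma to_fiber_surj: "to_fiber ` carrier Rees = fiber"
proof
  interpret H: ring_hom_ring Rees "ring_of fiber" to_fiber by (rule to_fiber_hom)
  let ?B = "to_fiber ` carrier Rees"
  have const: "constants \<subseteq> ?B"
  proof
    fix c :: "('v, 'k) mpoly" assume c: "c \<in> constants"
    then have "c \<in> A" using constants_subset by blast
    from imageI[OF const_Rees(1)[OF this], of to_fiber] const_Rees(2)[OF this] hom_comp_0_of_constant[OF c]
    show "c \<in> ?B" by simp
  qed
  have op: "a * b \<in> ?B" "a + b \<in> ?B" if ab: "a \<in> ?B" "b \<in> ?B" for a b
  proof -
    obtain f g where fg: "f \<in> carrier Rees" "g \<in> carrier Rees" and a: "a = to_fiber f" "b = to_fiber g"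
      using ab by blast
    have "a * b = to_fiber (f \<otimes>\<^bsub>Rees\<^esub> g)" "a + b = to_fiber (f \<oplus>\<^bsub>Rees\<^esub> g)"
      using H.hom_mult[OF fg] H.hom_add[OF fg] unfolding a by simp_all
    then show "a * b \<in> ?B" "a + b \<in> ?B" using H.R.m_closed[OF fg] H.R.a_closed[OF fg] by blast+
  qed
  have "is_subring ?B"
    unfolding is_subring_def
  proof (intro conjI ballI)
    show "0 \<in> ?B" "1 \<in> ?B" using const is_subringD(1,2)[OF constants_subring] by blast+
    fix a assume a: "a \<in> ?B"
    have "- 1 \<in> ?B" using const is_subringD(3)[OF constants_subring is_subringD(2)[OF constants_subring]] by blast
    from op(1)[OF this a] show "- a \<in> ?B" by simp
    fix b assume b: "b \<in> ?B"
    show "a * b \<in> ?B" "a + b \<in> ?B" by (rule op[OF a b])+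
  qed
  moreover have "set xs \<subseteq> ?B" 
  proof
    fix x assume "x \<in> set xs"
    from imageI[OF gen_Rees(1)[OF this], of to_fiber] gen_Rees(2)[OF this] show "x \<in> ?B" by simp
  qed
  ultimately show "fiber \<subseteq> ?B"
    using const is_subringD(1)[OF constants_subring] by (intro adjoin_least)
  show "?B \<subseteq> fiber" using to_fiber_closed by blast
qed

lemma to_fiber_eq_0:
  assumes f: "f \<in> carrier Rees" and "to_fiber f = 0"
  shows "f k \<in> mJpow k"
proof -
  have fk: "f i \<in> Jpow i" for i using f by (simp add: Rees_carrier)
  let ?p = "lead_poly f"
  have hc: "hom_comp (\<delta> * k) (poly.coeff ?p i) = (if i = k then hom_comp (\<delta> * k) (f k) else 0)" for i
    using degree_pos by (auto simp: coeff_lead_poly[OF f] hom_comp_hom_comp when_def)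
  have "0 = hom_comp (\<delta> * k) (\<Sum>i\<le>Polynomial.degree ?p. poly.coeff ?p i)"
    using assms(2) by (simp add: to_fiber_def poly_altdef)
  also have "\<dots> = (if k \<le> Polynomial.degree ?p then hom_comp (\<delta> * k) (f k) else 0)"
    by (simp add: hom_comp_sum hc)
  also have "\<dots> = hom_comp (\<delta> * k) (f k)"
    using coeff_eq_0[of ?p k] by (auto simp: coeff_lead_poly[OF f])
  finally show ?thesis using hom_comp_Jpow_eq_0[OF fk] by metis
qed

abbreviation "mRees \<equiv> genideal Rees ((\<lambda>a. up_ring.monom (UP R) a 0) ` \<mm>)"

lemma monom_eq: "a \<in> A \<Longrightarrow> up_ring.monom (UP R) a n = (\<lambda>k. if k = n then a else 0)"
  by (auto simp: UP_def mpoly_ring_eq)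

lemma monom_Rees: "a \<in> Jpow n \<Longrightarrow> (\<lambda>k. if k = n then a else 0) \<in> carrier Rees"
  using is_idealD(2)[OF ideal_Jpow] by (auto simp: Rees_carrier)

lemma mA: "\<mm> \<subseteq> A" by (rule is_idealD(1)[OF ideal_m])

lemma mRees_gens: "(\<lambda>a. up_ring.monom (UP R) a 0) ` \<mm> \<subseteq> carrier Rees"
  using mA monom_eq const_Rees(1) by fastforce

lemma ideal_mRees: "ideal mRees Rees"
proof -
  interpret Rees: cring Rees by (rule cring_Rees)
  show ?thesis by (rule Rees.genideal_ideal[OF mRees_gens])
qed

lemma mRees_add: "f \<in> mRees \<Longrightarrow> g \<in> mRees \<Longrightarrow> f \<oplus>\<^bsub>Rees\<^esub> g \<in> mRees"
  by (rule additive_subgroup.a_closed[OF ideal.axioms(1)[OF ideal_mRees]])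

lemma monom_mRees:
  assumes "y \<in> mJpow n"
  shows "(\<lambda>k. if k = n then y else 0) \<in> mRees"
  using assms
proof (induction rule: ideal_prod_induct)
  case (mult a b)
  interpret Rees: cring Rees by (rule cring_Rees)
  let ?a = "\<lambda>k::nat. if k = 0 then a else 0" and ?b = "\<lambda>k. if k = n then b else 0"
  have aA: "a \<in> A" using mA mult(1) by blast
  have "up_ring.monom (UP R) a 0 \<in> mRees"
    using Rees.genideal_self[OF mRees_gens] mult(1) by blast
  then have a: "?a \<in> mRees" unfolding monom_eq[OF aA] .
  have b: "?b \<in> carrier Rees" by (rule monom_Rees[OF mult(2)])
  have "?a \<otimes>\<^bsub>Rees\<^esub> ?b = (\<lambda>k. if k = n then a * b else 0)"
  proof (rule ext)
    fix k
    have "(?a \<otimes>\<^bsub>Rees\<^esub> ?b) k = (\<Sum>i\<le>k. if i = 0 then a * ?b k else 0)"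
      unfolding Rees_mult[OF const_Rees(1)[OF aA] b] by (intro sum.cong) auto
    then show "(?a \<otimes>\<^bsub>Rees\<^esub> ?b) k = (if k = n then a * b else 0)" by simp
  qed
  then show ?case using ideal.I_r_closed[OF ideal_mRees a b] by simp
next
  case (add x y)
  interpret I: ideal mRees Rees by (rule ideal_mRees)
  have "(\<lambda>k. if k = n then x + y else 0) = (\<lambda>k. if k = n then x else 0) \<oplus>\<^bsub>Rees\<^esub> (\<lambda>k. if k = n then y else 0)"
    using Rees_add[OF I.Icarr[OF add(3)] I.Icarr[OF add(4)]] by auto
  then show ?case using mRees_add[OF add(3,4)] by simp
qed

text \<open>
  An element of the Rees algebra is the finite sum of its homogeneous pieces; they are split off from
  the top.
\<close>

lemma mRees_from_components:
  assumes "f \<in> carrier Rees" "\<And>k. f k \<in> mJpow k" "\<And>k. k \<ge> n \<Longrightarrow> f k = 0"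
  shows "f \<in> mRees"
  using assms
proof (induction n arbitrary: f)
  case 0
  then have "f = \<zero>\<^bsub>Rees\<^esub>" by (auto simp: Rees_zero)
  then show ?case using ideal.axioms(1)[OF ideal_mRees] additive_subgroup.zero_closed by metis
next
  case (Suc n)
  interpret I: ideal mRees Rees by (rule ideal_mRees)
  let ?g = "f(n := 0)" and ?h = "\<lambda>k. if k = n then f n else 0"
  have g: "?g \<in> carrier Rees"
    using Suc.prems is_idealD(2)[OF ideal_Jpow, of n] by (auto simp: Rees_carrier)
  have "?g k \<in> mJpow k" for k
    using Suc.prems(2) is_idealD(2)[OF ideal_mJpow] by simp
  moreover have "?g k = 0" if "k \<ge> n" for k using Suc.prems(3)[of k] that by auto
  ultimately have "?g \<in> mRees" using Suc.IH[OF g] by blast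
  moreover have h: "?h \<in> mRees" using Suc.prems(2) by (rule monom_mRees)
  ultimately have "?g \<oplus>\<^bsub>Rees\<^esub> ?h \<in> mRees" using mRees_add by blast
  moreover have "?g \<oplus>\<^bsub>Rees\<^esub> ?h = f" using Rees_add[OF g I.Icarr[OF h]] by (auto simp: fun_eq_iff)
  ultimately show ?case by simp
qed

lemma kernel_to_fiber: "a_kernel Rees (ring_of fiber) to_fiber = mRees"
proof (rule equalityI)
  have ker: "f \<in> a_kernel Rees (ring_of fiber) to_fiber \<longleftrightarrow> f \<in> carrier Rees \<and> to_fiber f = 0" for f
    unfolding a_kernel_def' by simp
  show "a_kernel Rees (ring_of fiber) to_fiber \<subseteq> mRees"
  proof
    fix f assume "f \<in> a_kernel Rees (ring_of fiber) to_fiber"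
    then have f: "f \<in> carrier Rees" "to_fiber f = 0" unfolding ker by blast+
    obtain n where n: "\<And>k. k > n \<Longrightarrow> f k = 0" using f(1) by (auto simp: Rees_carrier)
    show "f \<in> mRees"
      by (rule mRees_from_components[OF f(1) to_fiber_eq_0[OF f], of "Suc n"]) (use n in auto)
  qed
  have "to_fiber (up_ring.monom (UP R) a 0) = 0" if "a \<in> \<mm>" for a
  proof -
    have a: "a \<in> A" "hom_comp 0 a = 0" using that by (auto simp: irrelevant_ideal_eq vanishing_below_def)
    show ?thesis unfolding monom_eq[OF a(1)] const_Rees(2)[OF a(1)] by (rule a(2))
  qed
  then have "(\<lambda>a. up_ring.monom (UP R) a 0) ` \<mm> \<subseteq> a_kernel Rees (ring_of fiber) to_fiber"
    using mRees_gens unfolding ker subset_iff by blast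
  then show "mRees \<subseteq> a_kernel Rees (ring_of fiber) to_fiber"
    using cring_Rees ring_hom_ring.kernel_is_ideal[OF to_fiber_hom]
    by (intro ring.genideal_minimal) (auto simp: cring_def)
qed

proposition analytic_spread_eq:
  "analytic_spread R \<mm> J = krull_dim (ring_of fiber)"
proof -
  interpret H: ring_hom_ring Rees "ring_of fiber" to_fiber by (rule to_fiber_hom)
  interpret I: ideal mRees Rees by (rule ideal_mRees)
  let ?F = "Rees Quot mRees"
  have "?F \<simeq> ring_of fiber"
    using H.FactRing_iso to_fiber_surj by (simp add: kernel_to_fiber)
  then obtain h where "h \<in> ring_iso ?F (ring_of fiber)" by (auto simp: is_ring_iso_def)
  then have "krull_dim ?F = krull_dim (ring_of fiber)"
    using I.quotient_is_cring[OF cring_Rees] cring_ring_of[OF fiber_subring] by (intro krull_dim_iso)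
  then show ?thesis by (simp add: analytic_spread_def special_fiber_def)
qed

end

section \<open>Binomial edge ideals\<close>

lemma edge_binomials_equigenerated:
  fixes E :: "nat set set"
  assumes G: "simple_graph n E" and xs: "set xs = {xvar i * yvar j - xvar j * yvar i | i j. {i, j} \<in> E}"
  shows "equigenerated (xy_vars n) 2 (xs :: (xy, 'k::field) mpoly list)"
proof
  have fin: "hom_comp 1 (mvar v) = (mvar v :: (xy, 'k) mpoly)" for v
    by (simp add: mvar_def hom_comp_single)
  have prod: "hom_comp 2 (mvar v * mvar w) = (mvar v * mvar w :: (xy, 'k) mpoly)" for v w
    using homogeneous_mult[OF fin fin, of v w] by (simp add: numeral_2_eq_2)
  show "hom_comp 2 x = x" if "x \<in> set xs" for x
    using that unfolding xs xvar_def yvar_def by (auto simp: hom_comp_diff prod)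
  show "set xs \<subseteq> polys_in (xy_vars n)"
  proof
    fix x assume "x \<in> set xs"
    then obtain i j where x: "x = xvar i * yvar j - xvar j * yvar i" "{i, j} \<in> E" unfolding xs by blast
    then have "i \<in> {1..n}" "j \<in> {1..n}" using G by (auto simp: simple_graph_def)
    then show "x \<in> polys_in (xy_vars n)"
      unfolding x xvar_def yvar_def
      by (intro is_subringD[OF is_subring_polys_in] mvar_in_polys_in) (auto simp: xy_vars_def)
  qed
qed simp

lemma edge_binomials_list:
  assumes "simple_graph n E"
  shows "\<exists>xs. set xs = {xvar i * yvar j - xvar j * yvar i :: (xy, 'k::field) mpoly | i j. {i, j} \<in> E}"
proof (rule finite_list)
  have "{xvar i * yvar j - xvar j * yvar i :: (xy, 'k) mpoly | i j. {i, j} \<in> E}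
      \<subseteq> (\<lambda>(i, j). xvar i * yvar j - xvar j * yvar i) ` ({1..n} \<times> {1..n})"
    using assms by (fastforce simp: simple_graph_def)
  then show "finite {xvar i * yvar j - xvar j * yvar i :: (xy, 'k) mpoly | i j. {i, j} \<in> E}"
    by (rule finite_subset) auto
qed

theorem theorem3p2:
  fixes n :: nat and E E' :: "nat set set"
  assumes "infinite (UNIV :: 'k::field set)"
    and "simple_graph n E" and "simple_graph n E'" and "E \<subseteq> E'"
  shows "analytic_spread (mpoly_ring (xy_vars n)) (irrelevant_ideal (xy_vars n))
           (binomial_edge_ideal n E :: (xy, 'k) mpoly set)
       \<le> analytic_spread (mpoly_ring (xy_vars n)) (irrelevant_ideal (xy_vars n))
           (binomial_edge_ideal n E' :: (xy, 'k) mpoly set)"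
proof -
  let ?f = "\<lambda>E. {xvar i * yvar j - xvar j * yvar i :: (xy, 'k) mpoly | i j. {i, j} \<in> E}"
  from edge_binomials_list[OF assms(2)] obtain xs where xs: "set xs = ?f E" ..
  from edge_binomials_list[OF assms(3)] obtain ys where ys: "set ys = ?f E'" ..
  interpret G: equigenerated "xy_vars n" 2 xs by (rule edge_binomials_equigenerated[OF assms(2) xs])
  interpret G': equigenerated "xy_vars n" 2 ys by (rule edge_binomials_equigenerated[OF assms(3) ys])
  have "set xs \<subseteq> set ys" unfolding xs ys using assms(4) by (intro Collect_mono) blast
  then have "set xs \<subseteq> adjoin constants ys" using G'.gens_fiber by (rule subset_trans)
  from krull_dim_mono[OF is_subfield_constants infinite_constants[OF assms(1)] this]
  show ?thesis
    unfolding binomial_edge_ideal_def xs[symmetric] ys[symmetric]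
    by (simp only: G.analytic_spread_eq G'.analytic_spread_eq)
qed

end
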